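(* Let $q\in\{2,3\}$ and let $M$ be a simple $GF(q)$-representable matroid, regarded as a restriction of $PG(r(M)-1,q)$, i.e. $E(M)\subseteq E(PG(r(M)-1,q))$. Then $M$ is a $GF(q)$-comatroid if and only if either $M$ is $U_{0,0}$, or for every flat $F$ of $PG(r(M)-1,q)$ with $r(F\cap E(M))=r(F-E(M))$, at least one of the matroids $PG(r(M)-1,q)|(F\cap E(M))$ and $PG(r(M)-1,q)|(F-E(M))$ is disconnected.
   Context: All matroids are simple. For $q\in\{2,3\}$ every simple $GF(q)$-representable matroid $M$ is uniquely $GF(q)$-representable, so for each $k\ge r(M)$ one can write $M\cong PG(k-1,q)|T$ for some set $T$, and the $(GF(q),k)$-complement of $M$ is the matroid $PG(k-1,q)\backslash T$, which is well defined up to isomorphism. A $GF(q)$-comatroid is defined recursively: (i) $U_{0,0}$ is a $GF(q)$-comatroid; (ii) the direct sum of two $GF(q)$-comatroids is a $GF(q)$-comatroid; (iii) if $M$ is a $GF(q)$-comatroid then so is its $(GF(q),t)$-complement for every $t\ge r(M)$. Ranks of subsets are ranks in $PG(r(M)-1,q)$. *)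

theory Defs
  imports Complex_Main "HOL-Library.Function_Algebras" "HOL-Library.Cardinality" "HOL-Library.FuncSet"
begin

section \<open>Matroids\<close>

record 'a matroid =
  ground :: "'a set"
  indeps :: "'a set set"

locale matroid =
  fixes M :: "'a matroid"
  assumes finite_ground: "finite (ground M)"
    and indeps_subset: "I \<in> indeps M \<Longrightarrow> I \<subseteq> ground M"
    and empty_indep: "{} \<in> indeps M"
    and indep_mono: "I \<in> indeps M \<Longrightarrow> J \<subseteq> I \<Longrightarrow> J \<in> indeps M"
    and augment: "I \<in> indeps M \<Longrightarrow> J \<in> indeps M \<Longrightarrow> card I < card J
                    \<Longrightarrow> \<exists>e\<in>J - I. insert e I \<in> indeps M"

definition rk :: "'a matroid \<Rightarrow> 'a set \<Rightarrow> nat" where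
  "rk M X = Max (card ` {I \<in> indeps M. I \<subseteq> X})"

definition rank :: "'a matroid \<Rightarrow> nat" where
  "rank M = rk M (ground M)"

definition circuit :: "'a matroid \<Rightarrow> 'a set \<Rightarrow> bool" where
  "circuit M C \<longleftrightarrow> C \<subseteq> ground M \<and> C \<notin> indeps M \<and> (\<forall>D. D \<subset> C \<longrightarrow> D \<in> indeps M)"

definition closure_of :: "'a matroid \<Rightarrow> 'a set \<Rightarrow> 'a set" where
  "closure_of M X = {e \<in> ground M. rk M (insert e X) = rk M X}"

definition flat :: "'a matroid \<Rightarrow> 'a set \<Rightarrow> bool" where
  "flat M F \<longleftrightarrow> F \<subseteq> ground M \<and> closure_of M F = F"

text \<open>No loops (circuits of size 1) and no parallel pairs (circuits of size 2).\<close>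

definition simple_matroid :: "'a matroid \<Rightarrow> bool" where
  "simple_matroid M \<longleftrightarrow> matroid M \<and> (\<forall>C. circuit M C \<longrightarrow> 3 \<le> card C)"

text \<open>Intended for \<open>T \<subseteq> ground M\<close>.\<close>

definition restrict_to :: "'a matroid \<Rightarrow> 'a set \<Rightarrow> 'a matroid" where
  "restrict_to M T = \<lparr>ground = T, indeps = {I \<in> indeps M. I \<subseteq> T}\<rparr>"

definition delete :: "'a matroid \<Rightarrow> 'a set \<Rightarrow> 'a matroid" where
  "delete M T = restrict_to M (ground M - T)"

text \<open>Intended for disjoint ground sets.\<close>

definition direct_sum :: "'a matroid \<Rightarrow> 'a matroid \<Rightarrow> 'a matroid" where
  "direct_sum M N =
     \<lparr>ground = ground M \<union> ground N, indeps = {I \<union> J | I J. I \<in> indeps M \<and> J \<in> indeps N}\<rparr>"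

definition isomorphic :: "'a matroid \<Rightarrow> 'b matroid \<Rightarrow> bool" where
  "isomorphic M N \<longleftrightarrow> matroid M \<and> matroid N \<and>
     (\<exists>f. bij_betw f (ground M) (ground N) \<and>
          (\<forall>X\<subseteq>ground M. X \<in> indeps M \<longleftrightarrow> f ` X \<in> indeps N))"

text \<open>
  A connected matroid has exactly one connected component; in particular the empty matroid,
  having no component, is not connected.  This convention matters for statements that quantify
  over all flats: the empty flat meets a set and its complement in two empty matroids.
\<close>

definition connected_matroid :: "'a matroid \<Rightarrow> bool" where
  "connected_matroid M \<longleftrightarrow> ground M \<noteq> {} \<and>
     (\<forall>e\<in>ground M. \<forall>f\<in>ground M. e \<noteq> f \<longrightarrow> (\<exists>C. circuit M C \<and> e \<in> C \<and> f \<in> C))"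

abbreviation disconnected_matroid :: "'a matroid \<Rightarrow> bool" where
  "disconnected_matroid M \<equiv> \<not> connected_matroid M"

definition U00 :: "'a matroid" where
  "U00 = \<lparr>ground = {}, indeps = {{}}\<rparr>"


section \<open>Projective geometries over a finite field\<close>

text \<open>
  The field \<open>GF(q)\<close> is a type \<open>'f\<close> of sort \<open>{field, finite}\<close> with \<open>CARD('f) = q\<close>.
  Vectors are functions \<open>nat \<Rightarrow> 'f\<close>, and \<open>GF(q)\<^sup>k\<close> consists of those vanishing from index \<open>k\<close> on.
\<close>

definition vscale :: "'f::field \<Rightarrow> (nat \<Rightarrow> 'f) \<Rightarrow> (nat \<Rightarrow> 'f)" where
  "vscale c v = (\<lambda>i. c * v i)"

global_interpretation vs: vector_space "vscale :: 'f::field \<Rightarrow> _"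
  by unfold_locales (auto simp: vscale_def fun_eq_iff algebra_simps)

definition coord_space :: "nat \<Rightarrow> (nat \<Rightarrow> 'f::field) set" where
  "coord_space k = {v. \<forall>i\<ge>k. v i = 0}"

text \<open>
  \<open>PG k\<close> is the projective geometry \<open>PG(k-1,q)\<close>, of rank \<open>k\<close>.  Its elements are the
  one-dimensional subspaces of \<open>GF(q)\<^sup>k\<close>; a set of them is independent if nonzero
  representatives of its members are linearly independent.
\<close>

definition PG_points :: "nat \<Rightarrow> (nat \<Rightarrow> 'f::field) set set" where
  "PG_points k = {vs.span {v} | v. v \<in> coord_space k \<and> v \<noteq> 0}"

definition PG :: "nat \<Rightarrow> (nat \<Rightarrow> 'f::{field,finite}) set matroid" where
  "PG k = \<lparr>ground = PG_points k,
           indeps = {X. X \<subseteq> PG_points k \<and>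
             (\<exists>\<rho>. (\<forall>p\<in>X. \<rho> p \<in> p \<and> \<rho> p \<noteq> 0) \<and> vs.independent (\<rho> ` X))}\<rparr>"

lemma finite_coord_space: "finite (coord_space k :: (nat \<Rightarrow> 'f::{field,finite}) set)"
proof -
  have "inj_on (\<lambda>v. restrict v {..<k}) (coord_space k :: (nat \<Rightarrow> 'f) set)"
  proof (rule inj_onI, rule ext)
    fix v w :: "nat \<Rightarrow> 'f" and i
    assume vw: "v \<in> coord_space k" "w \<in> coord_space k" "restrict v {..<k} = restrict w {..<k}"
    show "v i = w i"
    proof (cases "i < k")
      case True
      with fun_cong[OF vw(3), of i] show ?thesis by simp
    qed (use vw(1,2) in \<open>simp add: coord_space_def\<close>)
  qed
  moreover have "(\<lambda>v. restrict v {..<k}) ` (coord_space k :: (nat \<Rightarrow> 'f) set) \<subseteq> PiE {..<k} (\<lambda>_. UNIV)"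
    by (auto split: if_splits)
  ultimately show ?thesis
    by (rule inj_on_finite) (simp add: finite_PiE)
qed

lemma span_rep:
  fixes v w :: "nat \<Rightarrow> 'f::field"
  assumes "w \<in> vs.span {v}" "w \<noteq> 0" shows "vs.span {w} = vs.span {v}"
proof -
  obtain c where c: "w = vscale c v" using assms(1) by (auto simp: vs.span_singleton)
  with assms(2) have "c \<noteq> 0" by auto
  hence "v = vscale (inverse c) w" using c by simp
  moreover have "vscale (inverse c) w \<in> vs.span {w}"
    by (intro vs.span_scale vs.span_base) simp
  ultimately have "v \<in> vs.span {w}" by simp
  with assms(1) show ?thesis by (simp add: vs.span_eq)
qed

lemma matroid_PG: "matroid (PG k :: (nat \<Rightarrow> 'f::{field,finite}) set matroid)"
proof
  let ?P = "PG_points k :: (nat \<Rightarrow> 'f) set set"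
  show "finite (ground (PG k :: (nat \<Rightarrow> 'f) set matroid))"
    using finite_coord_space[of k, where 'f='f] by (simp add: PG_def PG_points_def)
  show "I \<subseteq> ground (PG k)" if "I \<in> indeps (PG k)" for I :: "(nat \<Rightarrow> 'f) set set"
    using that by (simp add: PG_def)
  show "{} \<in> indeps (PG k :: (nat \<Rightarrow> 'f) set matroid)"
    by (simp add: PG_def vs.independent_empty)
  show "J \<in> indeps (PG k)" if JI: "I \<in> indeps (PG k)" "J \<subseteq> I" for I J :: "(nat \<Rightarrow> 'f) set set"
  proof -
    obtain \<rho> where "I \<subseteq> ?P" "\<forall>p\<in>I. \<rho> p \<in> p \<and> \<rho> p \<noteq> 0" "vs.independent (\<rho> ` I)"
      using JI(1) by (auto simp: PG_def)
    moreover have "vs.independent (\<rho> ` J)" using calculation JI(2)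
      by (meson image_mono vs.independent_mono)
    ultimately have "J \<subseteq> ?P \<and> (\<forall>p\<in>J. \<rho> p \<in> p \<and> \<rho> p \<noteq> 0) \<and> vs.independent (\<rho> ` J)"
      using JI(2) by blast
    thus ?thesis unfolding PG_def by auto
  qed
  show "\<exists>e\<in>J - I. insert e I \<in> indeps (PG k)"
    if IJ: "I \<in> indeps (PG k)" "J \<in> indeps (PG k)" "card I < card J" for I J :: "(nat \<Rightarrow> 'f) set set"
  proof -
    obtain \<rho> where \<rho>: "I \<subseteq> ?P" "\<forall>p\<in>I. \<rho> p \<in> p \<and> \<rho> p \<noteq> 0" "vs.independent (\<rho> ` I)"
      using IJ(1) by (auto simp: PG_def)
    obtain \<sigma> where \<sigma>: "J \<subseteq> ?P" "\<forall>p\<in>J. \<sigma> p \<in> p \<and> \<sigma> p \<noteq> 0" "vs.independent (\<sigma> ` J)"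
      using IJ(2) by (auto simp: PG_def)
    have fin: "finite ?P" using finite_coord_space[of k, where 'f='f] by (simp add: PG_points_def)
    have P: "vs.span {w} = p" if "p \<in> ?P" "w \<in> p" "w \<noteq> 0" for p w
      using that span_rep by (auto simp: PG_points_def)
    have "inj_on \<sigma> J"
    proof (rule inj_onI)
      fix x y assume xy: "x \<in> J" "y \<in> J" "\<sigma> x = \<sigma> y"
      have "vs.span {\<sigma> x} = x" using P \<sigma>(1) bspec[OF \<sigma>(2)] xy(1) by (simp add: subset_iff)
      moreover have "vs.span {\<sigma> y} = y" using P \<sigma>(1) bspec[OF \<sigma>(2)] xy(2) by (simp add: subset_iff)
      ultimately show "x = y" unfolding xy(3) by (rule trans[OF sym])
    qed
    hence cJ: "card (\<sigma> ` J) = card J" by (rule card_image)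
    have finI: "finite I" by (rule finite_subset[OF \<rho>(1) fin])
    hence fI: "finite (\<rho> ` I)" by simp
    have cI: "card (\<rho> ` I) \<le> card I" by (rule card_image_le[OF finI])
    have "\<not> \<sigma> ` J \<subseteq> vs.span (\<rho> ` I)"
      using vs.independent_span_bound[OF fI \<sigma>(3)] cJ cI IJ(3) by linarith
    then obtain p where p: "p \<in> J" "\<sigma> p \<notin> vs.span (\<rho> ` I)" by blast
    have pI: "p \<notin> I"
    proof
      assume "p \<in> I"
      have "vs.span {\<rho> p} = p" using P \<rho>(1) bspec[OF \<rho>(2)] \<open>p \<in> I\<close> by (simp add: subset_iff)
      hence "\<sigma> p \<in> vs.span {\<rho> p}" using \<sigma>(2) p(1) by simp
      moreover have "vs.span {\<rho> p} \<subseteq> vs.span (\<rho> ` I)"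
        by (rule vs.span_mono) (use \<open>p \<in> I\<close> in simp)
      ultimately show False using p(2) by (simp add: subset_iff)
    qed
    have eq: "(\<rho>(p := \<sigma> p)) ` insert p I = insert (\<sigma> p) (\<rho> ` I)" using pI by auto
    have ind: "vs.independent ((\<rho>(p := \<sigma> p)) ` insert p I)" unfolding eq
      using p(2) \<rho>(3) by (rule vs.independent_insertI)
    have "insert p I \<subseteq> ?P \<and> (\<forall>x\<in>insert p I. (\<rho>(p := \<sigma> p)) x \<in> x \<and> (\<rho>(p := \<sigma> p)) x \<noteq> 0)"
      using p(1) \<rho>(1,2) \<sigma>(1,2) by auto
    with ind have "insert p I \<subseteq> ?P \<and> (\<exists>\<tau>. (\<forall>x\<in>insert p I. \<tau> x \<in> x \<and> \<tau> x \<noteq> 0) \<and>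
        vs.independent (\<tau> ` insert p I))"
      by (intro conjI exI[of _ "\<rho>(p := \<sigma> p)"]) simp_all
    hence "insert p I \<in> indeps (PG k)"
      unfolding PG_def matroid.simps mem_Collect_eq .
    thus ?thesis using p(1) pI by blast
  qed
qed

lemma matroid_restrict_to:
  assumes "matroid M" "T \<subseteq> ground M"
  shows "matroid (restrict_to M T)"
proof -
  interpret matroid M by fact
  show ?thesis
  proof
    show "finite (ground (restrict_to M T))"
      using finite_subset[OF assms(2) finite_ground] by (simp add: restrict_to_def)
    show "{} \<in> indeps (restrict_to M T)"
      by (simp add: restrict_to_def empty_indep)
  next
    fix I assume "I \<in> indeps (restrict_to M T)"
    then show "I \<subseteq> ground (restrict_to M T)" by (simp add: restrict_to_def)
  next
    fix I J assume "I \<in> indeps (restrict_to M T)" "J \<subseteq> I"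
    then show "J \<in> indeps (restrict_to M T)"
      using indep_mono[of I J] by (auto simp: restrict_to_def)
  next
    fix I J assume IJ: "I \<in> indeps (restrict_to M T)" "J \<in> indeps (restrict_to M T)" "card I < card J"
    then obtain e where "e \<in> J - I" "insert e I \<in> indeps M"
      using augment[of I J] by (auto simp: restrict_to_def)
    with IJ show "\<exists>e\<in>J - I. insert e I \<in> indeps (restrict_to M T)"
      by (intro bexI[of _ e]) (auto simp: restrict_to_def)
  qed
qed

definition representable :: "'f::{field,finite} itself \<Rightarrow> 'a matroid \<Rightarrow> bool" where
  "representable _ M \<longleftrightarrow> matroid M \<and>
     (\<exists>k. \<exists>\<phi> :: 'a \<Rightarrow> nat \<Rightarrow> 'f. \<phi> ` ground M \<subseteq> coord_space k \<and>
        (\<forall>X\<subseteq>ground M. X \<in> indeps M \<longleftrightarrow> inj_on \<phi> X \<and> vs.independent (\<phi> ` X)))"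


section \<open>Comatroids\<close>

text \<open>\<open>N\<close> is (a copy of) the \<open>(GF(q),k)\<close>-complement of \<open>M\<close>.\<close>

definition is_complement ::
    "nat \<Rightarrow> (nat \<Rightarrow> 'f::{field,finite}) set matroid \<Rightarrow> (nat \<Rightarrow> 'f) set matroid \<Rightarrow> bool" where
  "is_complement k M N \<longleftrightarrow>
     (\<exists>T \<subseteq> ground (PG k :: (nat \<Rightarrow> 'f) set matroid).
        isomorphic M (restrict_to (PG k) T) \<and> isomorphic N (delete (PG k) T))"

text \<open>
  Matroids on subsets of the type \<open>(nat \<Rightarrow> 'f) set\<close> of points: the type is infinite, so every
  finite matroid has a copy there, and any two have copies with disjoint ground sets.  Since
  complements are taken up to isomorphism, the class is closed under isomorphism.
\<close>

inductive comatroid :: "(nat \<Rightarrow> 'f::{field,finite}) set matroid \<Rightarrow> bool" where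
  empty: "comatroid U00"
| sum: "comatroid M \<Longrightarrow> comatroid N \<Longrightarrow> ground M \<inter> ground N = {} \<Longrightarrow> comatroid (direct_sum M N)"
| complement: "comatroid M \<Longrightarrow> rank M \<le> t \<Longrightarrow> is_complement t M N \<Longrightarrow> comatroid N"

end

theory Submission
  imports Defs
begin

text \<open>
  Call a set \<open>E\<close> of points separating if no subspace \<open>U\<close> is split by \<open>E\<close> into two connected sets of
  equal rank.  This property passes to complements within a subspace, because the condition is
  symmetric, and to direct sums, because a connected set meets only one summand.  So every comatroid
  is separating, provided the property depends only on the isomorphism type of \<open>E\<close>; this is the
  unique representability of binary and ternary matroids.

  For uniqueness, points are added one at a time to a linear map matching the two representations.
  If \<open>v\<close> and \<open>v'\<close> lie in the same spans of subsets of a connected \<open>T\<close>, then every hyperplane spanned by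
  \<open>T\<close> contains \<open>v - v'\<close> or \<open>v + v'\<close>, since the only nonzero scalars are \<open>1\<close> and \<open>-1\<close>; but a connected set
  spans a hyperplane avoiding any two given nonzero vectors of its span, so \<open>v' = v\<close> or \<open>v' = -v\<close>.

  Conversely, let \<open>E\<close> be separating in a subspace \<open>V\<close>.  If \<open>E\<close> or its complement in \<open>V\<close> has rank below
  \<open>dim V\<close>, that set is a comatroid by induction on the dimension.  Otherwise one of the two is
  disconnected and is the direct sum of two separating sets of smaller rank.  In all cases \<open>E\<close> or its
  complement is a comatroid, hence \<open>E\<close> is.
\<close>

section \<open>Rank functions and separations\<close>

text \<open>No ground set is fixed and the axioms concern finite sets, so that the dimension of sets
  of vectors, its pullbacks along maps and all contractions are instances.\<close>

locale rank_function =
  fixes r :: "'a set \<Rightarrow> nat"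
  assumes rank_empty: "r {} = 0"
    and mono: "finite Y \<Longrightarrow> X \<subseteq> Y \<Longrightarrow> r X \<le> r Y"
    and insert_le: "finite X \<Longrightarrow> r (insert x X) \<le> Suc (r X)"
    and submodular: "finite X \<Longrightarrow> finite Y \<Longrightarrow> r (X \<union> Y) + r (X \<inter> Y) \<le> r X + r Y"

text \<open>Connectivity in terms of separations: submodularity gives the weak inequality for every
  partition into two finite parts, and here it must be strict. The empty set is excluded to match
  \<open>connected_matroid\<close>.\<close>

definition inseparable :: "('a set \<Rightarrow> nat) \<Rightarrow> 'a set \<Rightarrow> bool" where
  "inseparable r T \<longleftrightarrow> T \<noteq> {} \<and>
     (\<forall>A B. A \<union> B = T \<longrightarrow> A \<inter> B = {} \<longrightarrow> A \<noteq> {} \<longrightarrow> B \<noteq> {} \<longrightarrow> r T < r A + r B)"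

text \<open>The rank function of the contraction by \<open>t\<close>, also when \<open>t\<close> is
  a loop. On finite sets monotonicity keeps the subtraction from truncating.\<close>

definition contract :: "('a set \<Rightarrow> nat) \<Rightarrow> 'a \<Rightarrow> 'a set \<Rightarrow> nat" where
  "contract r t X = r (insert t X) - r {t}"

definition rank_circuit :: "('a set \<Rightarrow> nat) \<Rightarrow> 'a set \<Rightarrow> bool" where
  "rank_circuit r C \<longleftrightarrow> finite C \<and> r C < card C \<and> (\<forall>D. D \<subset> C \<longrightarrow> r D = card D)"

lemma inseparableD:
  "inseparable r T \<Longrightarrow> A \<union> B = T \<Longrightarrow> A \<inter> B = {} \<Longrightarrow> A \<noteq> {} \<Longrightarrow> B \<noteq> {} \<Longrightarrow> r T < r A + r B"
  unfolding inseparable_def by blast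

lemma not_inseparableE:
  assumes "\<not> inseparable r T" "T \<noteq> {}"
  obtains A B where "A \<union> B = T" "A \<inter> B = {}" "A \<noteq> {}" "B \<noteq> {}" "r A + r B \<le> r T"
proof -
  from assms obtain A B where "A \<union> B = T" "A \<inter> B = {}" "A \<noteq> {}" "B \<noteq> {}" "\<not> r T < r A + r B"
    unfolding inseparable_def by blast
  then show thesis using that[of A B] by simp
qed

lemma inseparable_image:
  assumes "inj_on f T" and r: "\<And>X. X \<subseteq> T \<Longrightarrow> r' (f ` X) = r X"
  shows "inseparable r' (f ` T) \<longleftrightarrow> inseparable r T"
proof
  assume L: "inseparable r' (f ` T)"
  show "inseparable r T"
    unfolding inseparable_def
  proof (intro conjI allI impI)
    show "T \<noteq> {}" using L by (auto simp: inseparable_def)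
    fix A B assume AB: "A \<union> B = T" "A \<inter> B = {}" "A \<noteq> {}" "B \<noteq> {}"
    have "f ` A \<inter> f ` B = {}"
      using inj_on_image_Int[OF assms(1), of A B] AB by auto
    then have "r' (f ` T) < r' (f ` A) + r' (f ` B)"
      using AB by (intro inseparableD[OF L]) auto
    then show "r T < r A + r B" using AB using r[of T] r[of A] r[of B] by auto
  qed
next
  assume R: "inseparable r T"
  show "inseparable r' (f ` T)"
    unfolding inseparable_def
  proof (intro conjI allI impI)
    show "f ` T \<noteq> {}" using R by (auto simp: inseparable_def)
    fix A B assume AB: "A \<union> B = f ` T" "A \<inter> B = {}" "A \<noteq> {}" "B \<noteq> {}"
    define A' B' where "A' = {x\<in>T. f x \<in> A}" and "B' = {x\<in>T. f x \<in> B}"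
    have sub: "A \<subseteq> f ` T" "B \<subseteq> f ` T" using AB(1) by auto
    then have im: "f ` A' = A" "f ` B' = B" unfolding A'_def B'_def by auto
    have "f x \<in> A \<union> B" if "x \<in> T" for x using that AB(1) by simp
    then have "A' \<union> B' = T" unfolding A'_def B'_def by auto
    moreover have "A' \<inter> B' = {}" using AB(2) unfolding A'_def B'_def by auto
    moreover have "A' \<noteq> {}" "B' \<noteq> {}" using im AB by auto
    ultimately have "r T < r A' + r B'" by (intro inseparableD[OF R])
    moreover have "r' A = r A'" "r' B = r B'" 
      using r[of A'] r[of B'] im by (auto simp: A'_def B'_def)
    ultimately show "r' (f ` T) < r' A + r' B" by (simp add: r)
  qed
qed

text \<open>Strong induction on cardinality; its uses generalise over the rank function or the
  vectors, which change between steps.\<close>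

lemma card_subset_induct [consumes 1, case_names step]:
  assumes "finite T"
    and "\<And>T. finite T \<Longrightarrow> (\<And>S. finite S \<Longrightarrow> card S < card T \<Longrightarrow> P S) \<Longrightarrow> P T"
  shows "P T"
  using assms(1)
proof (induction "card T" arbitrary: T rule: less_induct)
  case less
  show ?case by (rule assms(2)) (use less in auto)
qed

context rank_function
begin

lemma rank_le_card: "finite X \<Longrightarrow> r X \<le> card X"
proof (induction X rule: finite_induct)
  case empty
  show ?case by (simp add: rank_empty)
next
  case (insert x X)
  then show ?case using insert_le[of X x] by simp
qed

lemma singleton_le: "r {x} \<le> 1"
  using rank_le_card[of "{x}"] by simp

lemma rank_image: "rank_function (\<lambda>X. r (f ` X))"
proof
  show "r (f ` {}) = 0" by (simp add: rank_empty)
  show "r (f ` X) \<le> r (f ` Y)" if "finite Y" "X \<subseteq> Y" for X Y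
    using that by (intro mono) auto
  show "r (f ` insert x X) \<le> Suc (r (f ` X))" if "finite X" for X x
    using that by (simp add: insert_le)
  show "r (f ` (X \<union> Y)) + r (f ` (X \<inter> Y)) \<le> r (f ` X) + r (f ` Y)" if "finite X" "finite Y" for X Y
  proof -
    have "r (f ` (X \<inter> Y)) \<le> r (f ` X \<inter> f ` Y)" using that by (intro mono) auto
    then show ?thesis using submodular[of "f ` X" "f ` Y"] that by (simp add: image_Un)
  qed
qed

lemma contract_eq: "finite X \<Longrightarrow> contract r t X + r {t} = r (insert t X)"
  unfolding contract_def using mono[of "insert t X" "{t}"] by simp

lemma rank_function_contract: "rank_function (contract r t)"
proof
  show "contract r t {} = 0" by (simp add: contract_def)
  show "contract r t X \<le> contract r t Y" if "finite Y" "X \<subseteq> Y" for X Y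
    unfolding contract_def using that by (intro diff_le_mono mono) auto
  show "contract r t (insert x X) \<le> Suc (contract r t X)" if "finite X" for X x
    using contract_eq[of X t] contract_eq[of "insert x X" t] that insert_le[of "insert t X" x]
    by (simp add: insert_commute)
  show "contract r t (X \<union> Y) + contract r t (X \<inter> Y) \<le> contract r t X + contract r t Y"
    if "finite X" "finite Y" for X Y
    using submodular[of "insert t X" "insert t Y"] contract_eq[of "X \<union> Y" t]
      contract_eq[of "X \<inter> Y" t] contract_eq[of X t] contract_eq[of Y t] that
    by simp
qed

text \<open>Submodularity for \<open>insert a X\<close> and \<open>Y\<close>, which meet in
  \<open>X\<close> when \<open>a\<close> is new: the gain from adding \<open>a\<close> cannot grow
  with the set.\<close>

lemma closure_insert_le:
  assumes "finite Y" "X \<subseteq> Y" "r (insert a X) = r X"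
  shows "r (insert a Y) = r Y"
proof (cases "a \<in> Y")
  case False
  then have "insert a X \<inter> Y = X" "insert a X \<union> Y = insert a Y" using assms(2) by auto
  then have "r (insert a Y) + r X \<le> r (insert a X) + r Y"
    using submodular[of "insert a X" Y] assms by (simp add: finite_subset)
  with assms mono[OF finite.insertI[OF assms(1)] subset_insertI, of a] show ?thesis by auto
qed (simp add: insert_absorb)

lemma closure_union:
  assumes "finite X" "finite Y" "\<And>y. y \<in> Y \<Longrightarrow> r (insert y X) = r X"
  shows "r (X \<union> Y) = r X"
  using assms(2,3)
proof (induction Y rule: finite_induct)
  case (insert y Y)
  have "r (insert y (X \<union> Y)) = r (X \<union> Y)"
    by (rule closure_insert_le[of _ X]) (use assms(1) insert.hyps insert.prems[of y] in simp_all)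
  moreover have "r (X \<union> Y) = r X" by (rule insert.IH) (simp add: insert.prems)
  ultimately show ?case by simp
qed simp

lemma ex_basis:
  assumes "finite X"
  shows "\<exists>I\<subseteq>X. r I = card I \<and> r I = r X"
  using assms
proof (induction X rule: finite_induct)
  case empty
  show ?case by (simp add: rank_empty)
next
  case (insert x X)
  then obtain I where I: "I \<subseteq> X" "r I = card I" "r I = r X" by blast
  show ?case
  proof (cases "r (insert x X) = r X")
    case True
    then show ?thesis using I by (intro exI[of _ I]) auto
  next
    case False
    have fI: "finite I" "x \<notin> I" using I(1) insert.hyps finite_subset by auto
    have "r (insert x I) \<noteq> r I" using closure_insert_le[OF insert.hyps(1) I(1)] False by blast
    moreover have "r I \<le> r (insert x I)" using fI by (intro mono) auto
    ultimately have xI: "r (insert x I) = Suc (r I)" using insert_le[OF fI(1), of x] by simp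
    moreover have "r (insert x I) \<le> r (insert x X)" using I insert.hyps by (intro mono) auto
    ultimately have "r (insert x X) = Suc (r I)" using insert_le[OF insert.hyps(1), of x] I(3) by simp
    then show ?thesis using I(1,2) fI xI by (intro exI[of _ "insert x I"]) auto
  qed
qed

text \<open>Connects abstract rank functions with \<open>rk\<close>, which is a maximum over
  independent sets.\<close>

lemma Max_card_independent:
  assumes "finite X"
  shows "Max (card ` {I. I \<subseteq> X \<and> r I = card I}) = r X"
proof (rule Max_eqI)
  show "finite (card ` {I. I \<subseteq> X \<and> r I = card I})" using assms by simp
  fix n assume "n \<in> card ` {I. I \<subseteq> X \<and> r I = card I}"
  then obtain I where "I \<subseteq> X" "r I = card I" "n = card I" by auto
  then show "n \<le> r X" using mono[OF assms, of I] by simp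
next
  obtain I where "I \<subseteq> X" "r I = card I" "r I = r X" using ex_basis[OF assms] by blast
  then show "r X \<in> card ` {I. I \<subseteq> X \<and> r I = card I}" by (intro image_eqI[of _ _ I]) auto
qed

text \<open>Due to Tutte.  Uncrossing a separation \<open>A, B\<close> of the deletion with a separation \<open>C, D\<close> of the
  contraction would yield a separation of \<open>T\<close> itself.\<close>

lemma inseparable_delete_or_contract:
  assumes fin: "finite T" and T: "inseparable r T" and t: "t \<in> T" "T \<noteq> {t}"
  shows "inseparable r (T - {t}) \<or> inseparable (contract r t) (T - {t})"
proof (rule ccontr)
  assume "\<not> ?thesis"
  then have n1: "\<not> inseparable r (T - {t})" and n2: "\<not> inseparable (contract r t) (T - {t})"
    by auto
  have ne: "T - {t} \<noteq> {}" using t by auto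
  obtain A B where AB: "A \<union> B = T - {t}" "A \<inter> B = {}" "A \<noteq> {}" "B \<noteq> {}" "r A + r B \<le> r (T - {t})"
    using not_inseparableE[OF n1 ne] by metis
  obtain C D where CD: "C \<union> D = T - {t}" "C \<inter> D = {}" "C \<noteq> {}" "D \<noteq> {}"
      "contract r t C + contract r t D \<le> contract r t (T - {t})"
    using not_inseparableE[OF n2 ne] by metis
  have finAB: "finite A" "finite B" "finite C" "finite D"
    using fin AB(1) CD(1) by (metis finite_Diff finite_Un)+
  have "insert t (T - {t}) = T" using t by auto
  \<comment> \<open>The extra 1 arises because the element \<open>t\<close> is counted in both
    summands.\<close>
  then have cd: "r (insert t C) + r (insert t D) \<le> r T + 1"
    using contract_eq[OF finAB(3), of t] contract_eq[OF finAB(4), of t]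
      contract_eq[of "T - {t}" t] fin CD(5) singleton_le[of t] by simp
  have ab: "r A + r B \<le> r T" using AB(5) mono[of T "T - {t}"] fin by auto
  \<comment> \<open>The sets are generalised because the claim is applied again with
    \<open>C\<close> and \<open>D\<close> exchanged.\<close>
  have key: "A \<inter> C = {} \<or> B \<inter> D = {}"
    if AB: "A \<union> B = T - {t}" "A \<inter> B = {}" and CD: "C \<union> D = T - {t}" "C \<inter> D = {}"
      and fin': "finite A" "finite B" "finite C" "finite D"
      and ab: "r A + r B \<le> r T" and cd: "r (insert t C) + r (insert t D) \<le> r T + 1" for A B C D
  proof (rule ccontr)
    assume "\<not> ?thesis"
    then have ne: "A \<inter> C \<noteq> {}" "B \<inter> D \<noteq> {}" by auto
    \<comment> \<open>The two strict inequalities make the sum of the four ranks at least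
      \<open>2 * r T + 2\<close>, while submodularity, \<open>ab\<close> and \<open>cd\<close> bound
      it by \<open>2 * r T + 1\<close>.\<close>
    have "r T < r (A \<inter> C) + r (insert t (B \<union> D))"
      using AB CD t ne by (intro inseparableD[OF T]) auto
    moreover have "r T < r (B \<inter> D) + r (insert t (A \<union> C))"
      using AB CD t ne by (intro inseparableD[OF T]) auto
    moreover have "A \<inter> insert t C = A \<inter> C" "B \<inter> insert t D = B \<inter> D" using AB by auto
    then have "r (insert t (A \<union> C)) + r (A \<inter> C) \<le> r A + r (insert t C)"
      "r (insert t (B \<union> D)) + r (B \<inter> D) \<le> r B + r (insert t D)"
      using submodular[of A "insert t C"] submodular[of B "insert t D"] fin' by simp_all
    ultimately show False using ab cd by linarith
  qed
  have "A \<inter> C = {} \<or> B \<inter> D = {}"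
    by (rule key) (use AB CD finAB ab cd in auto)
  moreover have "A \<inter> D = {} \<or> B \<inter> C = {}"
    by (rule key) (use AB CD finAB ab cd in auto)
  moreover have "A \<subseteq> C \<union> D" "B \<subseteq> C \<union> D" "C \<subseteq> A \<union> B" "D \<subseteq> A \<union> B"
    using AB(1) CD(1) by auto
  \<comment> \<open>Each of the four combinations leaves one of \<open>A\<close>, \<open>B\<close>,
    \<open>C\<close>, \<open>D\<close> disjoint from both parts of the other partition, hence
    empty.\<close>
  ultimately show False using AB(3,4) CD(3,4) by (elim disjE) blast+
qed

text \<open>The partition into \<open>{t}\<close> and the rest shows that \<open>t\<close> is
  neither a loop nor a coloop.\<close>

lemma inseparable_no_loop:
  assumes "finite T" "inseparable r T" "t \<in> T" "T \<noteq> {t}"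
  shows "r {t} = 1" and "r (T - {t}) = r T"
proof -
  have "r T < r {t} + r (T - {t})"
    using assms by (intro inseparableD) auto
  moreover have "r (T - {t}) \<le> r T" using assms(1) by (intro mono) auto
  ultimately show "r {t} = 1" "r (T - {t}) = r T" using singleton_le[of t] by auto
qed

section \<open>Circuits and their relation to separations\<close>

text \<open>For proper subsets \<open>D\<close> of \<open>C\<close> the set
  \<open>insert g D\<close> has full rank, so \<open>C\<close> is a circuit if it is dependent, and
  otherwise \<open>insert g C\<close> is one.\<close>

lemma rank_circuit_contractD:
  assumes C: "rank_circuit (contract r g) C" and g: "g \<notin> C" "r {g} = 1"
  shows "rank_circuit r C \<or> rank_circuit r (insert g C)"
proof -
  have fin: "finite C" using C by (simp add: rank_circuit_def)
  have cg: "r (insert g D) = Suc (contract r g D)" if "D \<subseteq> C" for D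
    using contract_eq[of D g] that fin g(2) by (simp add: finite_subset)
  have sub: "r (insert g D) = Suc (card D)" if "D \<subset> C" for D
    using C that cg[of D] by (auto simp: rank_circuit_def)
  have sub': "r D = card D" if "D \<subset> C" for D
    using sub[OF that] insert_le[of D g] rank_le_card[of D] that fin finite_subset[of D C] by auto
  show ?thesis
  proof (cases "r C < card C")
    case True
    then show ?thesis using fin sub' by (simp add: rank_circuit_def)
  next
    case False
    then have rC: "r C = card C" using rank_le_card[OF fin] by simp
    have "r D = card D" if D: "D \<subset> insert g C" for D
    proof (cases "g \<in> D")
      case True
      then have "D - {g} \<subset> C" "insert g (D - {g}) = D" using D g(1) by auto
      moreover have "finite D" using D fin finite_subset[of D "insert g C"] by auto
      ultimately show ?thesis using sub[of "D - {g}"] True card_Suc_Diff1[of D g] by simp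
    next
      case False
      then have "D \<subseteq> C" using D by auto
      then show ?thesis using sub' rC by blast
    qed
    moreover have "r (insert g C) < card (insert g C)"
      using C cg[of C] fin g(1) by (auto simp: rank_circuit_def)
    ultimately show ?thesis using fin by (simp add: rank_circuit_def)
  qed
qed

text \<open>Delete or contract a third element \<open>g\<close>, keeping inseparability; a circuit
  of the contraction lifts back, possibly with \<open>g\<close> added. The induction ends at the
  parallel pair \<open>{e, f}\<close>.\<close>

lemma inseparable_ex_rank_circuit:
  assumes "finite T" "inseparable r T" "e \<in> T" "f \<in> T" "e \<noteq> f"
  shows "\<exists>C\<subseteq>T. e \<in> C \<and> f \<in> C \<and> rank_circuit r C"
  using assms rank_function_axioms
proof (induction T arbitrary: r rule: card_subset_induct)
  case (step T r)
  interpret rank_function r by fact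
  show ?case
  proof (cases "T = {e, f}")
    case True
    have r1: "r {e} = 1" "r {f} = 1"
      using inseparable_no_loop(1)[OF step.hyps step.prems(1)] step.prems(2-4) by auto
    have "r {e, f} < 2"
      using inseparableD[OF step.prems(1), of "{e}" "{f}"] r1 True step.prems(4) by (simp add: insert_commute)
    moreover have "r D = card D" if "D \<subset> {e, f}" for D
    proof -
      have "D = {} \<or> D = {e} \<or> D = {f}" using that by blast
      then show ?thesis using r1 rank_empty by auto
    qed
    ultimately have "rank_circuit r {e, f}"
      using step.prems by (auto simp: rank_circuit_def)
    then show ?thesis using True by auto
  next
    case False
    then obtain g where g: "g \<in> T" "g \<noteq> e" "g \<noteq> f" using step.prems by blast
    have Tg: "T \<noteq> {g}" using step.prems g by auto
    have sm: "finite (T - {g})" "card (T - {g}) < card T"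
      using step.hyps g(1) card_Diff1_less[of T g] by blast+
    from inseparable_delete_or_contract[OF step.hyps step.prems(1) g(1) Tg]
    show ?thesis
    proof
      assume "inseparable r (T - {g})"
      from step.IH[OF sm this] step.prems g rank_function_axioms show ?thesis by blast
    next
      assume "inseparable (contract r g) (T - {g})"
      from step.IH[OF sm this] step.prems g rank_function_contract
      obtain C where C: "C \<subseteq> T - {g}" "e \<in> C" "f \<in> C" "rank_circuit (contract r g) C"
        by auto
      have "rank_circuit r C \<or> rank_circuit r (insert g C)"
        using C inseparable_no_loop(1)[OF step.hyps step.prems(1) g(1) Tg]
        by (intro rank_circuit_contractD) auto
      then show ?thesis using C g by (meson Diff_subset insert_subset insertI2 subset_trans)
    qed
  qed
qed

text \<open>Submodularity is used twice, for \<open>C \<union> A\<close> with \<open>B\<close> and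
  then for \<open>C\<close> with \<open>A\<close>; adding the two inequalities restricts the
  separation to \<open>C\<close>.\<close>

lemma separation_restrict:
  assumes fin: "finite A" "finite B" and "A \<inter> B = {}" "r A + r B \<le> r (A \<union> B)" and C: "C \<subseteq> A \<union> B"
  shows "r (C \<inter> A) + r (C \<inter> B) \<le> r C"
proof -
  have f: "finite C" using fin C finite_subset by blast
  have e: "C \<union> A \<union> B = A \<union> B" "(C \<union> A) \<inter> B = C \<inter> B" using assms by auto
  have "r (A \<union> B) + r (C \<inter> B) \<le> r (C \<union> A) + r B"
    using submodular[of "C \<union> A" B] f fin unfolding e by simp
  moreover have "r (C \<union> A) + r (C \<inter> A) \<le> r C + r A"
    using submodular[of C A] f fin by simp
  ultimately show ?thesis using assms(4) by linarith
qed

text \<open>A circuit meeting both sides would be cut into two proper, hence independent, parts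
  whose ranks add up to its cardinality.\<close>

lemma separation_no_rank_circuit:
  assumes fin: "finite T" and AB: "A \<union> B = T" "A \<inter> B = {}" "r A + r B \<le> r T"
    and C: "rank_circuit r C" "C \<subseteq> T" "C \<inter> A \<noteq> {}" "C \<inter> B \<noteq> {}"
  shows False
proof -
  have f: "finite A" "finite B" "finite C" using fin AB(1) C(2) by (auto intro: finite_subset)
  have "r (C \<inter> A) + r (C \<inter> B) \<le> r C"
    using AB C(2) f by (intro separation_restrict) auto
  moreover have "r (C \<inter> A) = card (C \<inter> A)" "r (C \<inter> B) = card (C \<inter> B)" "r C < card C"
    using C AB unfolding rank_circuit_def by (blast intro: psubsetI)+
  moreover have "card C = card (C \<inter> A) + card (C \<inter> B)"
  proof -
    have "C = (C \<inter> A) \<union> (C \<inter> B)" using C AB by auto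
    then show ?thesis using card_Un_disjoint[of "C \<inter> A" "C \<inter> B"] f AB by auto
  qed
  ultimately show False by linarith
qed

text \<open>The bridge from separations to the circuit condition in
  \<open>connected_matroid\<close>.\<close>

theorem inseparable_iff_rank_circuits:
  assumes "finite T"
  shows "inseparable r T \<longleftrightarrow> T \<noteq> {} \<and>
    (\<forall>e\<in>T. \<forall>f\<in>T. e \<noteq> f \<longrightarrow> (\<exists>C\<subseteq>T. rank_circuit r C \<and> e \<in> C \<and> f \<in> C))"
proof
  assume T: "inseparable r T"
  show "T \<noteq> {} \<and> (\<forall>e\<in>T. \<forall>f\<in>T. e \<noteq> f \<longrightarrow> (\<exists>C\<subseteq>T. rank_circuit r C \<and> e \<in> C \<and> f \<in> C))"
    using inseparable_ex_rank_circuit[OF assms T] T by (meson inseparable_def)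
next
  assume R: "T \<noteq> {} \<and> (\<forall>e\<in>T. \<forall>f\<in>T. e \<noteq> f \<longrightarrow> (\<exists>C\<subseteq>T. rank_circuit r C \<and> e \<in> C \<and> f \<in> C))"
  show "inseparable r T"
  proof (rule ccontr)
    assume n: "\<not> inseparable r T"
    obtain A B where AB: "A \<union> B = T" "A \<inter> B = {}" "A \<noteq> {}" "B \<noteq> {}" "r A + r B \<le> r T"
      using not_inseparableE[OF n] R by metis
    then obtain e f where ef: "e \<in> A" "f \<in> B" by blast
    with AB R obtain C where "C \<subseteq> T" "rank_circuit r C" "e \<in> C" "f \<in> C"
      by (metis UnI1 UnI2 disjoint_iff)
    then show False
      using separation_no_rank_circuit[OF assms AB(1,2,5)] ef by blast
  qed
qed

text \<open>Each step deletes or contracts an element that is parallel to neither \<open>a\<close> nor \<open>b\<close>; when all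
  elements are parallel to one of them, the empty set spans the desired hyperplane.\<close>

lemma inseparable_hyperplane_avoiding:
  assumes "finite T" "inseparable r T" "r {a} = 1" "r {b} = 1"
    "r (insert a T) = r T" "r (insert b T) = r T"
  shows "\<exists>X\<subseteq>T. r T = Suc (r X) \<and> r (insert a X) = r T \<and> r (insert b X) = r T"
  using assms rank_function_axioms
proof (induction T arbitrary: r rule: card_subset_induct)
  case (step T r)
  interpret rank_function r by fact
  note T = step.prems(1) and ab = step.prems(2-5) and fin = step.hyps
  have rT: "1 \<le> r T" using mono[of "insert a T" "{a}"] fin ab by simp
  show ?case
  proof (cases "r T = 1")
    case True
    then show ?thesis using ab rank_empty by (intro exI[of _ "{}"]) simp
  next
    case rT1: False
    show ?thesis
    proof (cases "\<exists>t\<in>T. r {a, t} = 2 \<and> r {b, t} = 2")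
      case True
      then obtain t where t: "t \<in> T" "r {a, t} = 2" "r {b, t} = 2" by auto
      have Tt: "T \<noteq> {t}" using rT rT1 singleton_le[of t] by auto
      have sm: "finite (T - {t})" "card (T - {t}) < card T"
        using fin t(1) card_Diff1_less[of T t] by blast+
      note nl = inseparable_no_loop[OF fin T t(1) Tt]
      from inseparable_delete_or_contract[OF fin T t(1) Tt]
      show ?thesis
      proof
        assume d: "inseparable r (T - {t})"
        have "r (insert c (T - {t})) = r (T - {t})" if "r (insert c T) = r T" for c
        proof (rule antisym)
          have "r (insert c (T - {t})) \<le> r (insert c T)" using fin by (intro mono) auto
          then show "r (insert c (T - {t})) \<le> r (T - {t})" using that nl(2) by simp
          show "r (T - {t}) \<le> r (insert c (T - {t}))" using fin by (intro mono) auto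
        qed
        from step.IH[OF sm d ab(1,2) this[OF ab(3)] this[OF ab(4)] rank_function_axioms] nl(2)
        obtain X where
          "X \<subseteq> T - {t}" "r T = Suc (r X) \<and> r (insert a X) = r T \<and> r (insert b X) = r T" by auto
        then show ?thesis by auto
      next
        assume d: "inseparable (contract r t) (T - {t})"
        let ?c = "contract r t"
        have c: "r (insert t X) = Suc (?c X)" if "finite X" for X
          using contract_eq[OF that, of t] nl by simp
        have it: "insert t (T - {t}) = T" using t by auto
        \<comment> \<open>Since \<open>t\<close> is parallel to neither \<open>a\<close> nor
          \<open>b\<close>, both remain nonloops in the contraction.\<close>
        have c1: "?c {a} = 1" "?c {b} = 1"
          using c[of "{a}"] c[of "{b}"] t by (simp_all add: insert_commute)
        have cT: "Suc (?c (T - {t})) = r T" using c[of "T - {t}"] fin it by simp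
        have "?c (insert s (T - {t})) = ?c (T - {t})" if "r (insert s T) = r T" for s
          using c[of "insert s (T - {t})"] fin that cT it by (simp add: insert_commute)
        from step.IH[OF sm d c1 this[OF ab(3)] this[OF ab(4)] rank_function_contract]
        obtain X where X: "X \<subseteq> T - {t}" "?c (T - {t}) = Suc (?c X)"
            "?c (insert a X) = ?c (T - {t})" "?c (insert b X) = ?c (T - {t})"
          by auto
        have finX: "finite X" using X fin finite_subset by blast
        show ?thesis
          using X c[of X] c[of "insert a X"] c[of "insert b X"] finX cT t
          by (intro exI[of _ "insert t X"]) (auto simp: insert_commute)
      qed
    next
      case False
      have le2: "r {s, t} \<le> 2" for s t using rank_le_card[of "{s, t}"] card_insert_le_m1[of 2 "{t}" s] by auto
      have par: "r {a, t} \<le> 1 \<or> r {b, t} \<le> 1" if "t \<in> T" for t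
              proof -
        have "r {a, t} \<noteq> 2 \<or> r {b, t} \<noteq> 2" using False that by blast
        then show ?thesis using le2[of a t] le2[of b t] by linarith
      qed
      \<comment> \<open>Every element now lies in the closure of \<open>a\<close> or of
        \<open>b\<close>, so \<open>T\<close> is covered by two sets of rank at most one. In rank at
        least two this contradicts inseparability.\<close>
      define A where "A = {t \<in> T. r {a, t} \<le> 1}"
      define B where "B = T - A"
      have fAB: "finite A" "finite B" unfolding A_def B_def using fin by auto
      have ge: "1 \<le> r {s, t}" if "r {s} = 1" for s t using mono[of "{s, t}" "{s}"] that by simp
      have A1: "r ({a} \<union> A) = r {a}"
      proof (rule closure_union)
        show "r (insert y {a}) = r {a}" if "y \<in> A" for y
          using that ge[OF ab(1), of y] ab(1) unfolding A_def by (simp add: insert_commute)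
      qed (use fAB in auto)
      have B1: "r ({b} \<union> B) = r {b}"
      proof (rule closure_union)
        show "r (insert y {b}) = r {b}" if "y \<in> B" for y
          using that par[of y] ge[OF ab(2), of y] ab(2) unfolding A_def B_def
          by (simp add: insert_commute)
      qed (use fAB in auto)
      have "r A \<le> 1" "r B \<le> 1"
        using mono[of "{a} \<union> A" A] mono[of "{b} \<union> B" B] A1 B1 ab fAB by auto
      moreover have "A \<union> B = T" "A \<inter> B = {}" unfolding A_def B_def by auto
      moreover have "r T \<ge> 2" using rT rT1 by simp
      ultimately have False
        using inseparableD[OF T, of A B] by (cases "A = {}"; cases "B = {}") auto
      then show ?thesis ..
    qed
  qed
qed

end

text \<open>A basis of \<open>X\<close> maps to an independent set of the same size, and a basis of
  the image pulls back to one.\<close>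

lemma rank_eq_of_independent_iff:
  assumes r: "rank_function r" "rank_function r'" and E: "finite E" "inj_on f E"
    and ind: "\<And>I. I \<subseteq> E \<Longrightarrow> r I = card I \<longleftrightarrow> r' (f ` I) = card (f ` I)"
    and X: "X \<subseteq> E"
  shows "r' (f ` X) = r X"
proof (rule antisym)
  interpret r: rank_function r by fact
  interpret r': rank_function r' by fact
  have fX: "finite X" using X E(1) finite_subset by blast
  obtain I where I: "I \<subseteq> X" "r I = card I" "r I = r X" using r.ex_basis[OF fX] by blast
  have "card (f ` I) = card I" using I(1) X E(2) by (meson card_image inj_on_subset)
  then have "r' (f ` I) = r X" using ind[of I] I X by auto
  then show "r X \<le> r' (f ` X)" using r'.mono[of "f ` X" "f ` I"] I(1) fX by auto
  obtain J where J: "J \<subseteq> f ` X" "r' J = card J" "r' J = r' (f ` X)"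
    using r'.ex_basis[of "f ` X"] fX by auto
  then obtain I' where I': "I' \<subseteq> X" "J = f ` I'" by (auto simp: subset_image_iff)
  have "card (f ` I') = card I'" using I'(1) X E(2) by (meson card_image inj_on_subset)
  then have "r I' = r' (f ` X)" using ind[of I'] I' J X by auto
  then show "r' (f ` X) \<le> r X" using r.mono[OF fX I'(1)] by auto
qed

section \<open>Ranks of sets of vectors\<close>

global_interpretation vp: vector_space_pair "vscale :: 'f::field \<Rightarrow> _" "vscale :: 'f \<Rightarrow> _"
  by unfold_locales

abbreviation lin :: "((nat \<Rightarrow> 'f::field) \<Rightarrow> (nat \<Rightarrow> 'f)) \<Rightarrow> bool" where
  "lin \<equiv> Vector_Spaces.linear vscale vscale"

lemma finite_span:
  fixes S :: "(nat \<Rightarrow> 'f::{field,finite}) set"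
  assumes "finite S"
  shows "finite (vs.span S)"
  using assms
proof (induction S rule: finite_induct)
  case (insert a S)
  have "vs.span (insert a S) \<subseteq> (\<Union>k. (\<lambda>x. x + vscale k a) ` vs.span S)"
  proof
    fix x assume "x \<in> vs.span (insert a S)"
    then obtain k where "x - vscale k a \<in> vs.span S" by (auto simp: vs.span_insert)
    then show "x \<in> (\<Union>k. (\<lambda>x. x + vscale k a) ` vs.span S)"
      by (intro UN_I[of k]) (auto intro!: image_eqI[of _ _ "x - vscale k a"])
  qed
  with insert show ?case by (auto intro: finite_subset)
qed simp

lemma basis_of_finite:
  fixes V :: "(nat \<Rightarrow> 'f::field) set"
  assumes "finite V"
  obtains B where "finite B" "B \<subseteq> V" "vs.independent B" "vs.span B = vs.span V" "card B = vs.dim V"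
proof -
  obtain B where B: "B \<subseteq> V" "vs.independent B" "V \<subseteq> vs.span B" "card B = vs.dim V"
    using vs.basis_exists by blast
  moreover have "vs.span B = vs.span V"
    using B by (simp add: vs.span_eq subset_iff vs.span_base)
  ultimately show thesis using that assms finite_subset by blast
qed

lemma vs_dim_mono:
  fixes V W :: "(nat \<Rightarrow> 'f::field) set"
  assumes "finite W" "V \<subseteq> vs.span W"
  shows "vs.dim V \<le> vs.dim W"
proof -
  obtain B where "finite B" "vs.span B = vs.span W" "card B = vs.dim W"
    using basis_of_finite[OF assms(1)] by metis
  then show ?thesis using vs.dim_le_card[of V B] assms(2) by simp
qed

lemma independent_card_le_vs_dim:
  fixes V :: "(nat \<Rightarrow> 'f::field) set"
  assumes "vs.independent B" "B \<subseteq> vs.span V" "finite V"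
  shows "card B \<le> vs.dim V"
  using vs_dim_mono[OF assms(3,2)] vs.dim_eq_card_independent[OF assms(1)] by simp

lemma vs_dim_eq_card_iff:
  fixes X :: "(nat \<Rightarrow> 'f::field) set"
  assumes "finite X"
  shows "vs.dim X = card X \<longleftrightarrow> vs.independent X"
proof
  assume d: "vs.dim X = card X"
  obtain B where "B \<subseteq> X" "vs.independent B" "card B = vs.dim X"
    using basis_of_finite[OF assms] by metis
  then show "vs.independent X" using card_subset_eq[OF assms, of B] d by simp
qed (rule vs.dim_eq_card_independent)

lemma vs_dim_insert:
  fixes S :: "(nat \<Rightarrow> 'f::field) set"
  assumes "finite S"
  shows "vs.dim (insert x S) = (if x \<in> vs.span S then vs.dim S else Suc (vs.dim S))"
proof (cases "x \<in> vs.span S")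
  case True
  then show ?thesis using vs.span_eq_dim[OF vs.span_redundant] by simp
next
  case False
  obtain B where B: "finite B" "vs.independent B" "vs.span B = vs.span S" "card B = vs.dim S"
    using basis_of_finite[OF assms] by metis
  have x: "x \<notin> vs.span B" "x \<notin> B" using False B vs.span_base by auto
  have "vs.span (insert x B) = vs.span (insert x S)" by (simp add: vs.span_insert B(3))
  then have "vs.dim (insert x S) = card (insert x B)"
    using vs.independent_insertI[OF x(1) B(2)] by (intro vs.dim_eq_card) auto
  then show ?thesis using x B False by simp
qed

lemma vs_dim_insert_eq_iff:
  fixes S :: "(nat \<Rightarrow> 'f::field) set"
  shows "finite S \<Longrightarrow> vs.dim (insert x S) = vs.dim S \<longleftrightarrow> x \<in> vs.span S"
  by (simp add: vs_dim_insert)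

lemma vs_dim_empty [simp]: "vs.dim ({} :: (nat \<Rightarrow> 'f::field) set) = 0"
  using vs.dim_le_card'[of "{} :: (nat \<Rightarrow> 'f) set"] by simp

lemma vs_dim_singleton: "vs.dim {x :: nat \<Rightarrow> 'f::field} = (if x = 0 then 0 else 1)"
  by (simp add: vs_dim_insert)

lemma rank_function_vs_dim:
  "rank_function (vs.dim :: (nat \<Rightarrow> 'f::field) set \<Rightarrow> nat)"
proof
  show "vs.dim X \<le> vs.dim Y" if "finite Y" "X \<subseteq> Y" for X Y :: "(nat \<Rightarrow> 'f) set"
    using that vs.span_superset[of Y] by (intro vs_dim_mono) auto
  show "vs.dim (insert x X) \<le> Suc (vs.dim X)" if "finite X" for X and x :: "nat \<Rightarrow> 'f"
    using that by (simp add: vs_dim_insert)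
  show "vs.dim (X \<union> Y) + vs.dim (X \<inter> Y) \<le> vs.dim X + vs.dim Y" if fin: "finite X" "finite Y"
    for X Y :: "(nat \<Rightarrow> 'f) set"
  proof -
    obtain B where B: "B \<subseteq> X \<inter> Y" "vs.independent B" "card B = vs.dim (X \<inter> Y)"
      using basis_of_finite[OF finite_Int[OF disjI1[OF fin(1)], of Y]] by metis
    \<comment> \<open>A basis of the intersection, extended to one of the union, meets
      \<open>X\<close> and \<open>Y\<close> in independent sets; counting its elements gives
      submodularity.\<close>
    obtain B' where B': "B \<subseteq> B'" "B' \<subseteq> X \<union> Y" "vs.independent B'" "X \<union> Y \<subseteq> vs.span B'"
      using vs.maximal_independent_subset_extend[of B "X \<union> Y"] B(1,2) by blast
    have fB': "finite B'" using B'(2) fin finite_subset by blast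
    have "vs.dim (X \<union> Y) = card B'" using B' by (simp add: vs.basis_card_eq_dim)
    moreover have "card B \<le> card (B' \<inter> X \<inter> Y)" using fB' B B' by (intro card_mono) auto
    moreover have "card (B' \<inter> X) \<le> vs.dim X" "card (B' \<inter> Y) \<le> vs.dim Y"
      using fin vs.span_superset[of X] vs.span_superset[of Y]
      by (auto intro!: independent_card_le_vs_dim vs.independent_mono[OF B'(3)])
    moreover have "card B' + card (B' \<inter> X \<inter> Y) = card (B' \<inter> X) + card (B' \<inter> Y)"
    proof -
      have "B' = (B' \<inter> X) \<union> (B' \<inter> Y)" "B' \<inter> X \<inter> Y = (B' \<inter> X) \<inter> (B' \<inter> Y)" using B'(2) by auto
      then show ?thesis using card_Un_Int[of "B' \<inter> X" "B' \<inter> Y"] fB' by (metis finite_Int)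
    qed
    ultimately show ?thesis using B(3) by linarith
  qed
qed simp

global_interpretation vdim: rank_function "vs.dim :: (nat \<Rightarrow> 'f::field) set \<Rightarrow> nat"
  by (rule rank_function_vs_dim)

lemma vs_span_eq_of_dim:
  fixes S T :: "(nat \<Rightarrow> 'f::field) set"
  assumes "finite T" "finite S" "S \<subseteq> vs.span T" "vs.dim T \<le> vs.dim S"
  shows "vs.span S = vs.span T"
proof (rule antisym)
  show "vs.span S \<subseteq> vs.span T" using assms(3) by (simp add: vs.span_minimal)
  have "x \<in> vs.span S" if "x \<in> T" for x
  proof -
    have "vs.dim (insert x S) \<le> vs.dim T"
      using assms that by (intro vs_dim_mono) (auto intro: vs.span_base)
    then show ?thesis using assms by (auto simp: vs_dim_insert split: if_splits)
  qed
  then show "vs.span T \<subseteq> vs.span S" by (intro vs.span_minimal) auto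
qed

section \<open>Separations as direct sums of spans, and linear maps on them\<close>

text \<open>Adding a nonzero common vector \<open>w\<close> to both sides would leave their ranks
  unchanged but give the intersection positive rank, against submodularity.\<close>

lemma separation_span_Int:
  fixes A B :: "(nat \<Rightarrow> 'f::field) set"
  assumes "finite A" "finite B" "vs.dim A + vs.dim B \<le> vs.dim (A \<union> B)"
    and w: "w \<in> vs.span A" "w \<in> vs.span B"
  shows "w = 0"
proof (rule ccontr)
  assume "w \<noteq> 0"
  have "vs.dim (insert w A \<union> insert w B) + vs.dim (insert w A \<inter> insert w B) \<le> vs.dim A + vs.dim B"
    using vdim.submodular[of "insert w A" "insert w B"] assms by (simp add: vs_dim_insert)
  moreover have "vs.dim {w} \<le> vs.dim (insert w A \<inter> insert w B)"
    using assms by (intro vdim.mono) auto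
  moreover have "vs.dim (A \<union> B) \<le> vs.dim (insert w A \<union> insert w B)"
    using assms by (intro vdim.mono) auto
  ultimately show False using assms(3) \<open>w \<noteq> 0\<close> by (simp add: vs_dim_singleton)
qed

text \<open>Enlarging \<open>X\<close> by all of \<open>B\<close> absorbs the component in
  \<open>B\<close>, so a condition on one component becomes a condition on the whole vector. The
  components are unique because the two spans meet only in 0.\<close>

lemma separation_component_span:
  fixes A B :: "(nat \<Rightarrow> 'f::field) set"
  assumes fin: "finite A" "finite B" and d: "vs.dim A + vs.dim B \<le> vs.dim (A \<union> B)"
    and X: "X \<subseteq> A" and x: "x\<^sub>1 \<in> vs.span A" "x\<^sub>2 \<in> vs.span B"
  shows "x\<^sub>1 \<in> vs.span X \<longleftrightarrow> x\<^sub>1 + x\<^sub>2 \<in> vs.span (X \<union> B)"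
proof
  assume "x\<^sub>1 + x\<^sub>2 \<in> vs.span (X \<union> B)"
  then obtain y z where yz: "x\<^sub>1 + x\<^sub>2 = y + z" "y \<in> vs.span X" "z \<in> vs.span B"
    unfolding vs.span_Un by auto
  have "y \<in> vs.span A" using yz(2) vs.span_mono[OF X] by auto
  then have m: "x\<^sub>1 - y \<in> vs.span A" "z - x\<^sub>2 \<in> vs.span B" using x yz by (auto intro: vs.span_diff)
  have "x\<^sub>1 = y + z - x\<^sub>2" using yz(1) by (simp add: eq_diff_eq)
  then have "x\<^sub>1 - y = z - x\<^sub>2" by simp
  with m have "x\<^sub>1 - y \<in> vs.span B" by simp
  from separation_span_Int[OF fin d m(1) this] show "x\<^sub>1 \<in> vs.span X" using yz(2) by simp
qed (use x in \<open>auto simp: vs.span_Un\<close>)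

text \<open>By counting, bases of the two sides are disjoint and together independent, so a linear
  map can be prescribed on each separately.\<close>

lemma linear_glue:
  fixes A B :: "(nat \<Rightarrow> 'f::field) set"
  assumes fin: "finite A" "finite B" and d: "vs.dim A + vs.dim B \<le> vs.dim (A \<union> B)"
    and h: "lin h\<^sub>1" "lin h\<^sub>2"
  obtains h where "lin h" "\<And>x. x \<in> vs.span A \<Longrightarrow> h x = h\<^sub>1 x" "\<And>x. x \<in> vs.span B \<Longrightarrow> h x = h\<^sub>2 x"
proof -
  obtain A' where A': "finite A'" "A' \<subseteq> A" "vs.independent A'" "vs.span A' = vs.span A" "card A' = vs.dim A"
    using basis_of_finite[OF fin(1)] by metis
  obtain B' where B': "finite B'" "B' \<subseteq> B" "vs.independent B'" "vs.span B' = vs.span B" "card B' = vs.dim B"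
    using basis_of_finite[OF fin(2)] by metis
  have "vs.span (A' \<union> B') = vs.span (A \<union> B)" by (simp add: vs.span_Un A'(4) B'(4))
  then have eq: "vs.dim (A' \<union> B') = vs.dim (A \<union> B)" by (rule vs.span_eq_dim)
  have c: "card (A' \<union> B') + card (A' \<inter> B') = card A' + card B'"
    using card_Un_Int[of A' B'] A' B' by simp
  have le: "vs.dim (A' \<union> B') \<le> card (A' \<union> B')"
    using A' B' by (intro vs.dim_le_card') auto
  have "card (A' \<inter> B') = 0" "vs.dim (A' \<union> B') = card (A' \<union> B')"
    using c le eq d A'(5) B'(5) by linarith+
  then have disj: "A' \<inter> B' = {}" and ind: "vs.independent (A' \<union> B')"
    using A' B' by (auto simp: vs_dim_eq_card_iff)
  obtain h where h': "lin h" "\<forall>x\<in>A' \<union> B'. h x = (if x \<in> A' then h\<^sub>1 x else h\<^sub>2 x)"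
    using vp.linear_independent_extend[OF ind, of "\<lambda>x. if x \<in> A' then h\<^sub>1 x else h\<^sub>2 x"] by blast
  show thesis
  proof (rule that[OF h'(1)])
    fix x assume "x \<in> vs.span A"
    then have x: "x \<in> vs.span A'" by (simp add: A'(4))
    show "h x = h\<^sub>1 x"
      by (rule vp.linear_eq_on[OF h'(1) h(1) x]) (simp add: h'(2))
  next
    fix x assume "x \<in> vs.span B"
    then have x: "x \<in> vs.span B'" by (simp add: B'(4))
    have "b \<notin> A'" if "b \<in> B'" for b using that disj by auto
    then show "h x = h\<^sub>2 x"
      by (intro vp.linear_eq_on[OF h'(1) h(2) x]) (simp add: h'(2))
  qed
qed

text \<open>Points determine their representatives only up to nonzero scalars; this makes spans
  independent of the choice.\<close>

lemma span_scaled_image: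
  fixes \<psi> :: "'a \<Rightarrow> nat \<Rightarrow> 'f::field"
  assumes g: "\<And>t. t \<in> T \<Longrightarrow> \<exists>c. c \<noteq> 0 \<and> \<phi> t = vscale c (\<psi> t)"
  shows "vs.span (\<phi> ` T) = vs.span (\<psi> ` T)"
proof -
  have "\<phi> t \<in> vs.span (\<psi> ` T)" if "t \<in> T" for t
    using g[OF that] vs.span_scale[OF vs.span_base[OF imageI[OF that, of \<psi>]]] by auto
  moreover have "\<psi> t \<in> vs.span (\<phi> ` T)" if t: "t \<in> T" for t
  proof -
    obtain c where c: "c \<noteq> 0" "\<phi> t = vscale c (\<psi> t)" using g[OF t] by blast
    then have "\<psi> t = vscale (inverse c) (\<phi> t)" by simp
    then show ?thesis using t by (metis imageI vs.span_base vs.span_scale)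
  qed
  ultimately show ?thesis by (auto simp: vs.span_eq)
qed

lemma linear_inj_on_of_dim:
  fixes S :: "(nat \<Rightarrow> 'f::field) set"
  assumes "finite S" "lin g" "vs.dim (g ` S) = vs.dim S"
  shows "inj_on g (vs.span S)"
proof -
  obtain B where B: "finite B" "B \<subseteq> S" "vs.independent B" "vs.span B = vs.span S" "card B = vs.dim S"
    using basis_of_finite[OF assms(1)] by metis
  have "vs.span (g ` B) = vs.span (g ` S)"
    by (simp add: vp.linear_span_image[OF assms(2)] B(4))
  then have "vs.dim (g ` B) = card B" using B(5) assms(3) vs.span_eq_dim by metis
  moreover have "vs.dim (g ` B) \<le> card (g ` B)" "card (g ` B) \<le> card B"
    using B(1) by (simp_all add: vs.dim_le_card' card_image_le)
  ultimately have "card (g ` B) = card B" "vs.dim (g ` B) = card (g ` B)" by auto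
  then have "inj_on g B" "vs.independent (g ` B)"
    using B(1) vs_dim_eq_card_iff[of "g ` B"] by (simp_all add: eq_card_imp_inj_on)
  then have "inj_on g (vs.span B)" by (intro vp.linear_inj_on_span_independent_image[OF assms(2)])
  then show ?thesis by (simp add: B(4))
qed

lemma linear_dim_image:
  fixes S :: "(nat \<Rightarrow> 'f::field) set"
  assumes "finite S" "lin g" "inj_on g (vs.span S)"
  shows "vs.dim (g ` S) = vs.dim S"
proof -
  obtain B where B: "finite B" "B \<subseteq> S" "vs.independent B" "vs.span B = vs.span S" "card B = vs.dim S"
    using basis_of_finite[OF assms(1)] by metis
  have "vs.independent (g ` B)"
    using vp.linear_independent_injective_image[OF assms(2) B(3)] assms(3) B(4) by simp
  moreover have "vs.span (g ` B) = vs.span (g ` S)"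
    by (simp add: vp.linear_span_image[OF assms(2)] B(4))
  ultimately have "vs.dim (g ` S) = card (g ` B)" by (intro vs.dim_eq_card) auto
  also have "\<dots> = card B"
    using assms(3) B(2) by (intro card_image inj_on_subset[OF assms(3)]) (auto intro: vs.span_base)
  finally show ?thesis using B(5) by simp
qed

section \<open>Unique representability over the fields with two and three elements\<close>

lemma small_field_units:
  fixes x :: "'f::{field,finite}"
  assumes "CARD('f) \<in> {2, 3}" "x \<noteq> 0"
  shows "x = 1 \<or> x = - 1"
proof (rule ccontr)
  assume n: "\<not> ?thesis"
  \<comment> \<open>A fourth element besides 0, 1 and \<open>x\<close>: in characteristic two
    \<open>x + 1\<close> serves, otherwise \<open>- 1\<close>.\<close>
  define y where "y = (if (1::'f) = - 1 then x + 1 else - 1)"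
  have "y \<noteq> 0" "y \<noteq> 1" "y \<noteq> x"
    using n assms(2) unfolding y_def by (auto simp: eq_neg_iff_add_eq_0)
  then have "card {0, 1, x, y} = 4" using n assms(2) by auto
  moreover have "card {0, 1, x, y} \<le> CARD('f)" by (intro card_mono) auto
  ultimately show False using assms(1) by auto
qed

lemma same_spans_connected:
  fixes T :: "(nat \<Rightarrow> 'f::{field,finite}) set"
  assumes q: "CARD('f) \<in> {2, 3}" and T: "finite T" "inseparable vs.dim T"
    and v: "v \<in> vs.span T" "v' \<in> vs.span T"
    and same: "\<And>X. X \<subseteq> T \<Longrightarrow> v \<in> vs.span X \<longleftrightarrow> v' \<in> vs.span X"
  shows "v' = v \<or> v' = - v"
proof (rule ccontr)
  assume n: "\<not> ?thesis"
  have "v - v' \<noteq> 0" "v + v' \<noteq> 0" using n by (auto simp: add_eq_0_iff)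
  then obtain X where X: "X \<subseteq> T" "vs.dim T = Suc (vs.dim X)"
      "vs.dim (insert (v - v') X) = vs.dim T" "vs.dim (insert (v + v') X) = vs.dim T"
    using vdim.inseparable_hyperplane_avoiding[OF T, of "v - v'" "v + v'"] T(1) v
    by (auto simp: vs_dim_singleton vs_dim_insert_eq_iff vs.span_add vs.span_diff)
  have fX: "finite X" using X(1) T(1) finite_subset by blast
  have nin: "v - v' \<notin> vs.span X" "v + v' \<notin> vs.span X"
    using X fX by (auto simp: vs_dim_insert split: if_splits)
  \<comment> \<open>If one of the two vectors were in the span of \<open>X\<close>, so would be the
    other by \<open>same\<close>, and with them the difference.\<close>
  have vX: "v \<notin> vs.span X" "v' \<notin> vs.span X"
    using nin same[OF X(1)] by (auto intro: vs.span_diff)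
  have "vs.span (insert v X) = vs.span T"
    using vX X fX T v by (intro vs_span_eq_of_dim) (auto simp: vs_dim_insert intro: vs.span_base)
  \<comment> \<open>\<open>X\<close> together with \<open>v\<close> spans everything, so
    \<open>v'\<close> is congruent to \<open>c\<close> times \<open>v\<close> modulo the hyperplane;
    \<open>c\<close> being 1 or -1 puts the difference or the sum into the hyperplane.\<close>
  with v(2) obtain c where c: "v' - vscale c v \<in> vs.span X" by (auto simp: vs.span_insert)
  then have "c \<noteq> 0" using vX by auto
  then have "c = 1 \<or> c = - 1" by (rule small_field_units[OF q])
  then show False
  proof
    assume "c = 1"
    then show False using vs.span_neg[OF c] nin by simp
  next
    assume "c = - 1"
    then show False using c nin by (simp add: add.commute)
  qed
qed

text \<open>\<open>T\<close> is split along separations; on an inseparable piece the two components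
  agree up to sign, so a scalar map works, and the scalar maps are glued. The result only rescales
  the vectors of \<open>T\<close>, so it can correct a map already matched on
  \<open>T\<close>.\<close>

lemma same_spans_linear:
  fixes T :: "(nat \<Rightarrow> 'f::{field,finite}) set"
  assumes q: "CARD('f) \<in> {2, 3}" and "finite T"
    and "v \<in> vs.span T" "v' \<in> vs.span T"
    and "\<And>X. X \<subseteq> T \<Longrightarrow> v \<in> vs.span X \<longleftrightarrow> v' \<in> vs.span X"
  shows "\<exists>h. lin h \<and> (\<forall>t\<in>T. \<exists>c. c \<noteq> 0 \<and> h t = vscale c t) \<and> h v = v'"
  using assms(2-)
proof (induction T arbitrary: v v' rule: card_subset_induct)
  case (step T v v')
  show ?case
  proof (cases "T = {} \<or> inseparable vs.dim T")
    case True
    then have "v' = v \<or> v' = - v"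
    proof
      assume "T = {}"
      then show ?thesis using step.prems by auto
    next
      assume "inseparable vs.dim T"
      from same_spans_connected[OF q step.hyps this step.prems] show ?thesis .
    qed
    then obtain c :: 'f where c: "c \<noteq> 0" "v' = vscale c v"
    proof
      assume "v' = v"
      then show thesis by (intro that[of 1]) auto
    next
      assume "v' = - v"
      then show thesis by (intro that[of "-1"]) auto
    qed
    have "lin (vscale c)"
      unfolding linear_iff by (auto simp: vs.scale_right_distrib vs.vector_space_axioms mult.commute)
    then show ?thesis using c by (intro exI[of _ "vscale c"]) auto
  next
    case False
    then have n: "\<not> inseparable vs.dim T" "T \<noteq> {}" by auto
    obtain A B where AB: "A \<union> B = T" "A \<inter> B = {}" "A \<noteq> {}" "B \<noteq> {}"
        "vs.dim A + vs.dim B \<le> vs.dim T"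
      using not_inseparableE[OF n] by metis
    have fin: "finite A" "finite B" using AB(1) step.hyps by auto
    have less: "card A < card T" "card B < card T"
      using AB step.hyps by (auto intro!: psubset_card_mono)
    note sep = AB(5)[folded AB(1)]
    have sep': "vs.dim B + vs.dim A \<le> vs.dim (B \<union> A)" using sep by (simp add: Un_commute add.commute)
    obtain v\<^sub>1 v\<^sub>2 where v: "v = v\<^sub>1 + v\<^sub>2" "v\<^sub>1 \<in> vs.span A" "v\<^sub>2 \<in> vs.span B"
      using step.prems(1) AB(1) vs.span_Un[of A B] by auto
    obtain w\<^sub>1 w\<^sub>2 where w: "v' = w\<^sub>1 + w\<^sub>2" "w\<^sub>1 \<in> vs.span A" "w\<^sub>2 \<in> vs.span B"
      using step.prems(2) AB(1) vs.span_Un[of A B] by auto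
    have "v\<^sub>1 \<in> vs.span X \<longleftrightarrow> w\<^sub>1 \<in> vs.span X" if X: "X \<subseteq> A" for X
    proof -
      have "X \<union> B \<subseteq> T" using X AB(1) by auto
      from step.prems(3)[OF this] show ?thesis
        unfolding separation_component_span[OF fin sep X v(2,3)]
          separation_component_span[OF fin sep X w(2,3)] v(1) w(1) .
    qed
    from step.IH[OF fin(1) less(1) v(2) w(2) this]
    obtain h\<^sub>1 where h1: "lin h\<^sub>1" "\<forall>t\<in>A. \<exists>c. c \<noteq> 0 \<and> h\<^sub>1 t = vscale c t" "h\<^sub>1 v\<^sub>1 = w\<^sub>1" by blast
    have "v\<^sub>2 \<in> vs.span X \<longleftrightarrow> w\<^sub>2 \<in> vs.span X" if X: "X \<subseteq> B" for X
    proof -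
      have "X \<union> A \<subseteq> T" using X AB(1) by auto
      from step.prems(3)[OF this] show ?thesis
        unfolding separation_component_span[OF fin(2,1) sep' X v(3,2)]
          separation_component_span[OF fin(2,1) sep' X w(3,2)] v(1) w(1)
          add.commute[of v\<^sub>1] add.commute[of w\<^sub>1] .
    qed
    from step.IH[OF fin(2) less(2) v(3) w(3) this]
    obtain h\<^sub>2 where h2: "lin h\<^sub>2" "\<forall>t\<in>B. \<exists>c. c \<noteq> 0 \<and> h\<^sub>2 t = vscale c t" "h\<^sub>2 v\<^sub>2 = w\<^sub>2" by blast
    obtain h where h: "lin h" "\<And>x. x \<in> vs.span A \<Longrightarrow> h x = h\<^sub>1 x" "\<And>x. x \<in> vs.span B \<Longrightarrow> h x = h\<^sub>2 x"
      using linear_glue[OF fin sep h1(1) h2(1)] by metis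
    have "\<exists>c. c \<noteq> 0 \<and> h t = vscale c t" if "t \<in> T" for t
      using that h1(2) h2(2) h(2,3)[OF vs.span_base, of t] AB(1) by auto
    moreover have "h v = v'"
      using h(2)[OF v(2)] h(3)[OF v(3)] h1(3) h2(3) by (simp add: v(1) w(1) vp.linear_add[OF h(1)])
    ultimately show ?thesis using h(1) by blast
  qed
qed

text \<open>The map is extended by one vector \<open>e\<close> at a time. Its value is free if
  \<open>\<phi> e\<close> is outside the span so far; otherwise \<open>g (\<phi> e)\<close> is moved
  to \<open>\<psi> e\<close> by a linear map that rescales each earlier
  \<open>\<psi> t\<close>.\<close>

theorem unique_representation:
  fixes \<phi> \<psi> :: "'a \<Rightarrow> nat \<Rightarrow> 'f::{field,finite}"
  assumes q: "CARD('f) \<in> {2, 3}" and "finite T"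
    and "\<And>X. X \<subseteq> T \<Longrightarrow> vs.dim (\<phi> ` X) = vs.dim (\<psi> ` X)"
  shows "\<exists>g. lin g \<and> (\<forall>t\<in>T. \<exists>c. c \<noteq> 0 \<and> g (\<phi> t) = vscale c (\<psi> t))"
  using assms(2-)
proof (induction T rule: finite_induct)
  case empty
  show ?case using vs.linear_id by blast
next
  case (insert e T)
  obtain g where g: "lin g" "\<forall>t\<in>T. \<exists>c. c \<noteq> 0 \<and> g (\<phi> t) = vscale c (\<psi> t)"
    using insert.IH insert.prems by blast
  have in_iff: "\<phi> e \<in> vs.span (\<phi> ` Y) \<longleftrightarrow> \<psi> e \<in> vs.span (\<psi> ` Y)" if "Y \<subseteq> T" for Y
  proof -
    have "finite Y" "Y \<subseteq> insert e T" using that insert.hyps(1) finite_subset by auto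
    then show ?thesis
      using insert.prems[of "insert e Y"] insert.prems[of Y] vs_dim_insert_eq_iff[of "\<phi> ` Y" "\<phi> e"]
        vs_dim_insert_eq_iff[of "\<psi> ` Y" "\<psi> e"] by auto
  qed
  show ?case
  proof (cases "\<phi> e \<in> vs.span (\<phi> ` T)")
    case False
    then have "\<phi> e \<noteq> 0" using vs.span_zero by metis
    then have "vs.independent {\<phi> e}" by simp
    then obtain k where k: "lin k" "k (\<phi> e) = \<psi> e"
      using vp.linear_independent_extend[of "{\<phi> e}" "\<lambda>_. \<psi> e"] by auto
    have "vs.dim {\<phi> e} + vs.dim (\<phi> ` T) \<le> vs.dim ({\<phi> e} \<union> \<phi> ` T)"
      using False \<open>\<phi> e \<noteq> 0\<close> insert.hyps(1) by (simp add: vs_dim_insert vs_dim_singleton)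
    then obtain h where h: "lin h" "\<And>x. x \<in> vs.span {\<phi> e} \<Longrightarrow> h x = k x"
        "\<And>x. x \<in> vs.span (\<phi> ` T) \<Longrightarrow> h x = g x"
      using linear_glue[of "{\<phi> e}" "\<phi> ` T" k g] k(1) g(1) insert.hyps(1) by auto
    have "h (\<phi> e) = vscale 1 (\<psi> e)" using h(2)[OF vs.span_base] k(2) by simp
    moreover have "\<forall>t\<in>T. h (\<phi> t) = g (\<phi> t)" using h(3)[OF vs.span_base] by auto
    ultimately show ?thesis using h(1) g(2) by (intro exI[of _ h]) (auto intro: exI[of _ 1])
  next
    case True
    have im: "vs.span (g ` \<phi> ` Y) = vs.span (\<psi> ` Y)" if "Y \<subseteq> T" for Y
      unfolding image_image using g(2) that by (intro span_scaled_image) auto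
    have "vs.dim (g ` \<phi> ` T) = vs.dim (\<phi> ` T)"
      using vs.span_eq_dim[OF im[OF order_refl]] insert.prems[OF subset_insertI] by simp
    \<comment> \<open>Injectivity carries membership in spans through \<open>g\<close>, so
      \<open>g (\<phi> e)\<close> and \<open>\<psi> e\<close> lie in the same spans of subsets of
      the earlier vectors.\<close>
    then have inj: "inj_on g (vs.span (\<phi> ` T))"
      using insert.hyps(1) g(1) by (intro linear_inj_on_of_dim) auto
    have ge: "g (\<phi> e) \<in> vs.span (\<psi> ` Y) \<longleftrightarrow> \<phi> e \<in> vs.span (\<phi> ` Y)" if "Y \<subseteq> T" for Y
    proof -
      have "vs.span (\<phi> ` Y) \<subseteq> vs.span (\<phi> ` T)" using that by (intro vs.span_mono) auto
      then show ?thesis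
        using inj_on_image_mem_iff[OF inj True] im[OF that, symmetric] vp.linear_span_image[OF g(1), of "\<phi> ` Y"]
        by simp
    qed
    have "g (\<phi> e) \<in> vs.span X \<longleftrightarrow> \<psi> e \<in> vs.span X" if X: "X \<subseteq> \<psi> ` T" for X
    proof -
      obtain Y where "Y \<subseteq> T" "X = \<psi> ` Y" using X by (auto simp: subset_image_iff)
      then show ?thesis using ge in_iff by simp
    qed
    then obtain h where h: "lin h" "\<forall>t\<in>\<psi> ` T. \<exists>c. c \<noteq> 0 \<and> h t = vscale c t" "h (g (\<phi> e)) = \<psi> e"
      using same_spans_linear[OF q, of "\<psi> ` T" "g (\<phi> e)" "\<psi> e"] insert.hyps(1) True ge in_iff by auto
    have "\<exists>c. c \<noteq> 0 \<and> h (g (\<phi> t)) = vscale c (\<psi> t)" if t: "t \<in> T" for t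
    proof -
      obtain c where c: "c \<noteq> 0" "g (\<phi> t) = vscale c (\<psi> t)" using g(2) t by blast
      obtain d where d: "d \<noteq> 0" "h (\<psi> t) = vscale d (\<psi> t)" using h(2) t by blast
      have "h (g (\<phi> t)) = vscale (c * d) (\<psi> t)" by (simp add: c(2) d(2) vp.linear_scale[OF h(1)])
      then show ?thesis using c d by (intro exI[of _ "c * d"]) auto
    qed
    moreover have "h (g (\<phi> e)) = vscale 1 (\<psi> e)" using h(3) by simp
    moreover have "lin (\<lambda>x. h (g x))"
      using Vector_Spaces.linear_compose[OF g(1) h(1)] by (simp add: o_def)
    ultimately show ?thesis by (intro exI[of _ "\<lambda>x. h (g x)"]) (auto intro: exI[of _ 1])
  qed
qed

section \<open>Points of projective space\<close>

text \<open>Extends \<open>PG_points\<close> from coordinate spaces to arbitrary sets of vectors;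
  applied to subspaces it gives the flats.\<close>

definition pts :: "(nat \<Rightarrow> 'f::field) set \<Rightarrow> (nat \<Rightarrow> 'f) set set" where
  "pts W = {vs.span {v} | v. v \<in> W \<and> v \<noteq> 0}"

definition rep :: "(nat \<Rightarrow> 'f::field) set \<Rightarrow> (nat \<Rightarrow> 'f)" where
  "rep p = (SOME v. v \<in> p \<and> v \<noteq> 0)"

text \<open>Pulling \<open>vs.dim\<close> back along one fixed choice \<open>rep\<close> gives a
  rank function at once; by \<open>span_reps\<close> other representatives of points span the same
  space.\<close>

definition prank :: "(nat \<Rightarrow> 'f::field) set set \<Rightarrow> nat" where
  "prank X = vs.dim (rep ` X)"

lemma PG_points_eq_pts: "PG_points k = pts (coord_space k)"
  by (simp add: PG_points_def pts_def)

global_interpretation prank: rank_function "prank :: (nat \<Rightarrow> 'f::field) set set \<Rightarrow> nat"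
  unfolding prank_def using vdim.rank_image[of rep] .

lemma pts_UNIV: "p \<in> pts W \<Longrightarrow> p \<in> pts UNIV"
  unfolding pts_def by auto

lemma pts_mono: "V \<subseteq> W \<Longrightarrow> pts V \<subseteq> pts W"
  unfolding pts_def by auto

lemma subset_pts_UNIV: "X \<subseteq> pts W \<Longrightarrow> X \<subseteq> pts UNIV"
  using pts_mono[of W UNIV] by simp

lemma finite_pts: "finite W \<Longrightarrow> finite (pts W)"
  unfolding pts_def by simp

lemma span_point: "p \<in> pts UNIV \<Longrightarrow> w \<in> p \<Longrightarrow> w \<noteq> 0 \<Longrightarrow> vs.span {w} = p"
  unfolding pts_def using span_rep by blast

lemma rep_point:
  assumes "p \<in> pts UNIV"
  shows "rep p \<in> p" "rep p \<noteq> 0" "vs.span {rep p} = p"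
proof -
  obtain v where "v \<noteq> 0" "p = vs.span {v}" using assms by (auto simp: pts_def)
  then have "\<exists>v. v \<in> p \<and> v \<noteq> 0" by (auto intro: vs.span_base)
  then have "rep p \<in> p \<and> rep p \<noteq> 0" unfolding rep_def by (rule someI_ex)
  then show "rep p \<in> p" "rep p \<noteq> 0" by auto
  then show "vs.span {rep p} = p" using span_point[OF assms] by simp
qed

lemma inj_on_rep: "X \<subseteq> pts UNIV \<Longrightarrow> inj_on rep X"
  by (metis inj_onI rep_point(3) subsetD)

lemma rep_in_subspace:
  assumes W: "vs.subspace W" and p: "p \<in> pts W"
  shows "rep p \<in> W"
proof -
  obtain v where v: "v \<in> W" "p = vs.span {v}" using p by (auto simp: pts_def)
  then have "p \<subseteq> W" using vs.span_minimal[of "{v}" W] W by simp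
  then show ?thesis using rep_point(1)[OF pts_UNIV[OF p]] by blast
qed

lemma in_ptsI:
  assumes "p \<in> pts UNIV" "rep p \<in> W"
  shows "p \<in> pts W"
  using rep_point(2,3)[OF assms(1)] assms(2) unfolding pts_def by blast

lemma subset_pts_span_rep:
  assumes "A \<subseteq> pts UNIV"
  shows "A \<subseteq> pts (vs.span (rep ` A))"
proof
  fix p assume p: "p \<in> A"
  show "p \<in> pts (vs.span (rep ` A))"
    by (rule in_ptsI) (use p assms in \<open>auto intro: vs.span_base\<close>)
qed

lemma span_reps:
  assumes "X \<subseteq> pts UNIV" "\<And>p. p \<in> X \<Longrightarrow> \<rho> p \<in> p \<and> \<rho> p \<noteq> 0"
  shows "vs.span (\<rho> ` X) = vs.span (rep ` X)"
proof (rule span_scaled_image)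
  fix p assume p: "p \<in> X"
  then have "\<rho> p \<in> vs.span {rep p}" using assms rep_point(3)[of p] by auto
  then obtain c where "\<rho> p = vscale c (rep p)" by (auto simp: vs.span_singleton)
  then show "\<exists>c. c \<noteq> 0 \<and> \<rho> p = vscale c (rep p)" using assms(2)[OF p] by auto
qed

text \<open>With \<open>x\<close> in \<open>U\<close> but not in \<open>W\<close>, every
  \<open>u\<close> in both subspaces is \<open>(u + x) - x\<close>, a difference of two vectors of
  \<open>U\<close> outside \<open>W\<close>.\<close>

lemma span_rep_pts_diff:
  assumes U: "vs.subspace U" and W: "vs.subspace W" and nsub: "\<not> U \<subseteq> W"
  shows "vs.span (rep ` (pts U - pts W)) = U"
proof (rule antisym)
  show "vs.span (rep ` (pts U - pts W)) \<subseteq> U"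
    using U rep_in_subspace[OF U] by (intro vs.span_minimal) auto
  have out: "u \<in> vs.span (rep ` (pts U - pts W))" if u: "u \<in> U" "u \<notin> W" for u
  proof -
    have u0: "u \<noteq> 0" using u(2) vs.subspace_0[OF W] by auto
    define p where "p = vs.span {u}"
    have pU: "p \<in> pts U" using u(1) u0 by (auto simp: p_def pts_def)
    note r = rep_point[OF pts_UNIV[OF pU]]
    have "u \<in> vs.span {rep p}" using r(3) by (auto simp: p_def intro: vs.span_base)
    then obtain c where c: "u = vscale c (rep p)" by (auto simp: vs.span_singleton)
    then have "rep p \<notin> W" using u(2) vs.subspace_scale[OF W] by blast
    then have "p \<in> pts U - pts W" using pU rep_in_subspace[OF W] by blast
    then show ?thesis unfolding c by (intro vs.span_scale vs.span_base imageI)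
  qed
  obtain x where x: "x \<in> U" "x \<notin> W" using nsub by auto
  show "U \<subseteq> vs.span (rep ` (pts U - pts W))"
  proof
    fix u assume u: "u \<in> U"
    show "u \<in> vs.span (rep ` (pts U - pts W))"
    proof (cases "u \<in> W")
      case True
      then have "u + x \<notin> W" using x(2) vs.subspace_diff[OF W, of "u + x" u] by auto
      then have "u + x - x \<in> vs.span (rep ` (pts U - pts W))"
        using u x U by (intro vs.span_diff out) (auto intro: vs.subspace_add)
      then show ?thesis by simp
    qed (use u out in auto)
  qed
qed

lemma span_rep_pts:
  fixes U :: "(nat \<Rightarrow> 'f::field) set"
  assumes "vs.subspace U"
  shows "vs.span (rep ` pts U) = U"
proof (cases "U \<subseteq> {0}")
  case True
  then have "pts U = {}" "U = {0}" using vs.subspace_0[OF assms] by (auto simp: pts_def)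
  then show ?thesis by simp
next
  case False
  have "vs.subspace {0 :: nat \<Rightarrow> 'f}" by (simp add: vs.subspace_def)
  moreover have "pts {0 :: nat \<Rightarrow> 'f} = {}" by (simp add: pts_def)
  ultimately show ?thesis using span_rep_pts_diff[OF assms, of "{0}"] False by simp
qed

lemma prank_pts: "vs.subspace U \<Longrightarrow> prank (pts U) = vs.dim U"
  unfolding prank_def using vs.dim_span[of "rep ` pts U"] by (simp add: span_rep_pts)

section \<open>Flats whose two parts are not both connected\<close>

text \<open>The subspaces \<open>U\<close> range over all finite ones, not only those of an ambient \<open>GF(q)\<^sup>k\<close>: if \<open>U\<close> is
  not contained in the span of \<open>E\<close>, then the points of \<open>U\<close> outside \<open>E\<close> span \<open>U\<close> while those in \<open>E\<close> do
  not, so the two ranks differ.\<close>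

definition separating :: "(nat \<Rightarrow> 'f::field) set set \<Rightarrow> bool" where
  "separating E \<longleftrightarrow> (\<forall>U. vs.subspace U \<longrightarrow> finite U \<longrightarrow>
     prank (pts U \<inter> E) = prank (pts U - E) \<longrightarrow>
     \<not> (inseparable prank (pts U \<inter> E) \<and> inseparable prank (pts U - E)))"

lemma separatingI:
  assumes "\<And>U. vs.subspace U \<Longrightarrow> finite U \<Longrightarrow> prank (pts U \<inter> E) = prank (pts U - E) \<Longrightarrow>
     inseparable prank (pts U \<inter> E) \<Longrightarrow> inseparable prank (pts U - E) \<Longrightarrow> False"
  shows "separating E"
  using assms unfolding separating_def by blast

lemma separatingD:
  assumes "separating E" "vs.subspace U" "finite U" "prank (pts U \<inter> E) = prank (pts U - E)"
    "inseparable prank (pts U \<inter> E)" "inseparable prank (pts U - E)"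
  shows False
  using assms unfolding separating_def by blast

text \<open>Otherwise the points of \<open>U\<close> outside \<open>E\<close> have full rank by
  \<open>span_rep_pts_diff\<close>, hence so do those in \<open>E\<close>, which forces
  \<open>U\<close> into \<open>W\<close>. This confines the test for \<open>separating\<close> to an
  ambient subspace.\<close>

lemma subspace_le_of_equal_ranks:
  assumes W: "vs.subspace W" "E \<subseteq> pts W" and U: "vs.subspace U" "finite U"
    and eq: "prank (pts U \<inter> E) = prank (pts U - E)"
  shows "U \<subseteq> W"
proof (rule ccontr)
  assume n: "\<not> U \<subseteq> W"
  have fin: "finite (pts U)" using U(2) by (rule finite_pts)
  have "vs.dim U = prank (pts U - pts W)"
    unfolding prank_def using vs.dim_span[of "rep ` (pts U - pts W)"] span_rep_pts_diff[OF U(1) W(1) n] by simp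
  also have "\<dots> \<le> prank (pts U - E)" using W(2) fin by (intro prank.mono) auto
  finally have "vs.dim U \<le> vs.dim (rep ` (pts U \<inter> E))" using eq by (simp add: prank_def)
  moreover have "rep ` (pts U \<inter> E) \<subseteq> vs.span U" using rep_in_subspace[OF U(1)] vs.span_base by blast
  ultimately have "vs.span (rep ` (pts U \<inter> E)) = vs.span U"
    using U(2) fin by (intro vs_span_eq_of_dim) auto
  moreover have "vs.span (rep ` (pts U \<inter> E)) \<subseteq> W"
    using W rep_in_subspace[OF W(1)] by (intro vs.span_minimal) auto
  ultimately show False using n vs.span_superset[of U] by auto
qed

text \<open>For \<open>U\<close> inside \<open>V\<close> the two parts are merely exchanged, and for
  other \<open>U\<close> the ranks differ.\<close>

lemma separating_complement:
  assumes "separating E" "vs.subspace V" "E \<subseteq> pts V"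
  shows "separating (pts V - E)"
proof (rule separatingI)
  fix U :: "(nat \<Rightarrow> 'a) set"
  assume U: "vs.subspace U" "finite U"
    and h: "prank (pts U \<inter> (pts V - E)) = prank (pts U - (pts V - E))"
      "inseparable prank (pts U \<inter> (pts V - E))" "inseparable prank (pts U - (pts V - E))"
  have "U \<subseteq> V" using subspace_le_of_equal_ranks[OF assms(2) _ U h(1)] by auto
  then have "pts U \<inter> (pts V - E) = pts U - E" "pts U - (pts V - E) = pts U \<inter> E"
    using pts_mono by blast+
  then show False using separatingD[OF assms(1) U] h by simp
qed

text \<open>Inside \<open>V\<close> the intersection changes nothing. This passes the property to
  the components of a disconnected set.\<close>

lemma separating_Int_pts:
  assumes "separating E" "vs.subspace V"
  shows "separating (E \<inter> pts V)"
proof (rule separatingI)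
  fix U :: "(nat \<Rightarrow> 'a) set"
  assume U: "vs.subspace U" "finite U"
    and h: "prank (pts U \<inter> (E \<inter> pts V)) = prank (pts U - E \<inter> pts V)"
      "inseparable prank (pts U \<inter> (E \<inter> pts V))" "inseparable prank (pts U - E \<inter> pts V)"
  have "U \<subseteq> V" using subspace_le_of_equal_ranks[OF assms(2) _ U h(1)] by auto
  then have "pts U \<inter> (E \<inter> pts V) = pts U \<inter> E" "pts U - E \<inter> pts V = pts U - E"
    using pts_mono by blast+
  then show False using separatingD[OF assms(1) U] h by simp
qed

text \<open>If \<open>U\<close> meets both summands, its part in the union inherits the separation
  and is not inseparable; if it misses one, the condition for the other applies.\<close>

lemma separating_sum:
  assumes E: "separating E\<^sub>1" "separating E\<^sub>2" "finite E\<^sub>1" "finite E\<^sub>2" "E\<^sub>1 \<inter> E\<^sub>2 = {}"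
    and sep: "prank E\<^sub>1 + prank E\<^sub>2 \<le> prank (E\<^sub>1 \<union> E\<^sub>2)"
  shows "separating (E\<^sub>1 \<union> E\<^sub>2)"
proof (rule separatingI)
  fix U :: "(nat \<Rightarrow> 'a) set"
  let ?E = "E\<^sub>1 \<union> E\<^sub>2"
  assume U: "vs.subspace U" "finite U"
    and h: "prank (pts U \<inter> ?E) = prank (pts U - ?E)"
      "inseparable prank (pts U \<inter> ?E)" "inseparable prank (pts U - ?E)"
  have le: "prank (pts U \<inter> E\<^sub>1) + prank (pts U \<inter> E\<^sub>2) \<le> prank (pts U \<inter> ?E)"
  proof -
    have "pts U \<inter> ?E \<inter> E\<^sub>1 = pts U \<inter> E\<^sub>1" "pts U \<inter> ?E \<inter> E\<^sub>2 = pts U \<inter> E\<^sub>2" by auto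
    then show ?thesis using prank.separation_restrict[OF E(3-5) sep, of "pts U \<inter> ?E"] by simp
  qed
  consider "pts U \<inter> E\<^sub>1 = {}" | "pts U \<inter> E\<^sub>2 = {}" | "pts U \<inter> E\<^sub>1 \<noteq> {}" "pts U \<inter> E\<^sub>2 \<noteq> {}" by blast
  then show False
  proof cases
    case 1
    then have "pts U \<inter> ?E = pts U \<inter> E\<^sub>2" "pts U - ?E = pts U - E\<^sub>2" by auto
    then show ?thesis using separatingD[OF E(2) U] h by simp
  next
    case 2
    then have "pts U \<inter> ?E = pts U \<inter> E\<^sub>1" "pts U - ?E = pts U - E\<^sub>1" by auto
    then show ?thesis using separatingD[OF E(1) U] h by simp
  next
    case 3
    have "prank (pts U \<inter> ?E) < prank (pts U \<inter> E\<^sub>1) + prank (pts U \<inter> E\<^sub>2)"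
      using 3 E(5) by (intro inseparableD[OF h(2)]) auto
    then show ?thesis using le by simp
  qed
qed

section \<open>The action of injective linear maps on points\<close>

context
  fixes g :: "(nat \<Rightarrow> 'f::field) \<Rightarrow> (nat \<Rightarrow> 'f)" and V
  assumes g: "lin g" and V: "vs.subspace V" "finite V" and inj: "inj_on g V"
begin

lemma image_point:
  assumes "p \<in> pts V"
  shows "g ` p = vs.span {g (rep p)}" "g (rep p) \<noteq> 0" "g ` p \<in> pts (g ` V)"
proof -
  note r = rep_point[OF pts_UNIV[OF assms]]
  have pV: "rep p \<in> V" using assms by (rule rep_in_subspace[OF V(1)])
  show im: "g ` p = vs.span {g (rep p)}"
    using vp.linear_span_image[OF g, of "{rep p}"] r(3) by simp
  have "g (rep p) \<noteq> g 0"
    using inj_onD[OF inj, of "rep p" 0] pV r(2) vs.subspace_0[OF V(1)] by auto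
  then show nz: "g (rep p) \<noteq> 0" by (simp add: vp.linear_0[OF g])
  show "g ` p \<in> pts (g ` V)" using im nz pV unfolding pts_def by auto
qed

lemma pts_image: "pts (g ` V) = (`) g ` pts V"
proof
  show "(`) g ` pts V \<subseteq> pts (g ` V)" using image_point(3) by auto
  show "pts (g ` V) \<subseteq> (`) g ` pts V"
  proof
    fix p assume "p \<in> pts (g ` V)"
    then obtain v where v: "v \<in> V" "g v \<noteq> 0" "p = vs.span {g v}" by (auto simp: pts_def)
    then have "p = g ` vs.span {v}" using vp.linear_span_image[OF g, of "{v}"] by simp
    moreover have "v \<noteq> 0" using v(2) vp.linear_0[OF g] by auto
    then have "vs.span {v} \<in> pts V" using v(1) by (auto simp: pts_def)
    ultimately show "p \<in> (`) g ` pts V" by auto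
  qed
qed

lemma inj_on_image_points: "inj_on ((`) g) (pts V)"
proof (rule inj_onI)
  fix p p' assume p: "p \<in> pts V" "p' \<in> pts V" "g ` p = g ` p'"
  have "q \<subseteq> V" if q: "q \<in> pts V" for q
  proof -
    have "rep q \<in> V" "vs.span {rep q} = q"
      using rep_point(3)[OF pts_UNIV[OF q]] rep_in_subspace[OF V(1) q] by auto
    then show ?thesis using vs.span_minimal[of "{rep q}" V] V(1) by auto
  qed
  then show "p = p'" using inj_on_image_eq_iff[OF inj] p by metis
qed

lemma prank_image_points:
  assumes "X \<subseteq> pts V"
  shows "prank ((`) g ` X) = prank X"
proof -
  have sub: "rep ` X \<subseteq> V" using assms rep_in_subspace[OF V(1)] by auto
  have fin: "finite (rep ` X)" using sub V(2) finite_subset by blast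
  have "vs.span (rep ` (`) g ` X) = vs.span (g ` rep ` X)"
    unfolding image_image
  proof (rule span_scaled_image)
    fix p assume "p \<in> X"
    then have p: "p \<in> pts V" using assms by auto
    note i = image_point[OF p]
    note r = rep_point[OF pts_UNIV[OF i(3)]]
    obtain c where "rep (g ` p) = vscale c (g (rep p))"
      using r(1) i(1) by (auto simp: vs.span_singleton)
    then show "\<exists>c. c \<noteq> 0 \<and> rep (g ` p) = vscale c (g (rep p))" using r(2) by auto
  qed
  then have "prank ((`) g ` X) = vs.dim (g ` rep ` X)"
    unfolding prank_def by (rule vs.span_eq_dim)
  also have "\<dots> = vs.dim (rep ` X)"
    using fin g inj_on_subset[OF inj] vs.span_minimal[OF sub V(1)] by (intro linear_dim_image) auto
  finally show ?thesis by (simp add: prank_def)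
qed

end

text \<open>A subspace with equal ranks lies in the image of \<open>V\<close>, so it is the image of
  a subspace of \<open>V\<close>, and \<open>g\<close> preserves ranks and inseparability
  there.\<close>

lemma separating_image:
  fixes g :: "(nat \<Rightarrow> 'f::field) \<Rightarrow> (nat \<Rightarrow> 'f)"
  assumes g: "lin g" and V: "vs.subspace V" "finite V" and inj: "inj_on g V"
    and E: "E \<subseteq> pts V" and s: "separating E"
  shows "separating ((`) g ` E)"
proof (rule separatingI)
  fix U' :: "(nat \<Rightarrow> 'f) set"
  let ?E = "(`) g ` E"
  assume U': "vs.subspace U'" "finite U'"
    and h: "prank (pts U' \<inter> ?E) = prank (pts U' - ?E)"
      "inseparable prank (pts U' \<inter> ?E)" "inseparable prank (pts U' - ?E)"
  note inj_points = inj_on_image_points[OF g V inj]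
  have gV: "vs.subspace (g ` V)" by (rule vp.linear_subspace_image[OF g V(1)])
  have "?E \<subseteq> pts (g ` V)" using E by (auto simp: pts_image[OF g V inj])
  then have le: "U' \<subseteq> g ` V" using subspace_le_of_equal_ranks[OF gV _ U' h(1)] by auto
  define U where "U = V \<inter> {x. g x \<in> U'}"
  have U: "vs.subspace U" "finite U" "U \<subseteq> V"
    unfolding U_def using V(2) vp.linear_subspace_linear_preimage[OF g U'(1)] V(1)
    by (auto intro: vs.subspace_inter)
  have gU: "U' = g ` U" unfolding U_def using le by auto
  have "pts U' = (`) g ` pts U"
    unfolding gU by (rule pts_image[OF g U(1,2) inj_on_subset[OF inj U(3)]])
  then have eqs: "pts U' \<inter> ?E = (`) g ` (pts U \<inter> E)" "pts U' - ?E = (`) g ` (pts U - E)"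
    using inj_on_image_Int[OF inj_points, of "pts U" E]
      inj_on_image_set_diff[OF inj_points _ E, of "pts U"] pts_mono[OF U(3)] E by (simp_all add: Diff_subset subset_iff)
  have sub: "pts U \<inter> E \<subseteq> pts V" "pts U - E \<subseteq> pts V" using pts_mono[OF U(3)] by auto
  have tr: "inseparable prank ((`) g ` X) \<longleftrightarrow> inseparable prank X" if "X \<subseteq> pts V" for X
    using that inj_on_subset[OF inj_points that] prank_image_points[OF g V inj]
    by (intro inseparable_image) auto
  show False
    using separatingD[OF s U(1,2)] h unfolding eqs
    using prank_image_points[OF g V inj sub(1)] prank_image_points[OF g V inj sub(2)] tr[OF sub(1)] tr[OF sub(2)] by simp
qed

text \<open>By \<open>unique_representation\<close> the bijection \<open>f\<close>, known only to
  preserve ranks, is induced by a linear map, and \<open>separating_image\<close> applies.\<close>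

lemma separating_of_rank_isomorphism:
  fixes f :: "(nat \<Rightarrow> 'f::{field,finite}) set \<Rightarrow> (nat \<Rightarrow> 'f) set"
  assumes q: "CARD('f) \<in> {2, 3}" and E: "finite E" "E \<subseteq> pts UNIV" "f ` E \<subseteq> pts UNIV"
    and rk: "\<And>X. X \<subseteq> E \<Longrightarrow> prank (f ` X) = prank X" and s: "separating E"
  shows "separating (f ` E)"
proof -
  have "\<exists>g. lin g \<and> (\<forall>p\<in>E. \<exists>c. c \<noteq> 0 \<and> g (rep p) = vscale c (rep (f p)))"
    using rk by (intro unique_representation[OF q E(1)]) (simp add: prank_def image_image)
  then obtain g where g: "lin g" "\<And>p. p \<in> E \<Longrightarrow> \<exists>c. c \<noteq> 0 \<and> g (rep p) = vscale c (rep (f p))"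
    by blast
  define V where "V = vs.span (rep ` E)"
  have sp: "vs.span (g ` rep ` E) = vs.span (rep ` f ` E)"
    unfolding image_image by (rule span_scaled_image[OF g(2)])
  have "vs.dim (g ` rep ` E) = vs.dim (rep ` E)"
    using rk[OF order_refl] vs.span_eq_dim[OF sp] by (simp add: prank_def)
  then have inj: "inj_on g V" unfolding V_def using E(1) g(1) by (intro linear_inj_on_of_dim) auto
  have V: "vs.subspace V" "finite V" unfolding V_def using E(1) by (auto intro: finite_span)
  have EV: "E \<subseteq> pts V" unfolding V_def by (rule subset_pts_span_rep[OF E(2)])
  have "g ` p = f p" if p: "p \<in> E" for p
  proof -
    obtain c where c: "c \<noteq> 0" "g (rep p) = vscale c (rep (f p))" using g(2)[OF p] by blast
    have "g ` p = vs.span {g (rep p)}" "g (rep p) \<noteq> 0"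
      using image_point[OF g(1) V inj] EV p by auto
    moreover have "f p \<in> pts UNIV" using p E(3) by auto
    note r = rep_point[OF this]
    then have "g (rep p) \<in> f p" using c(2) vs.span_scale[OF vs.span_base[of "rep (f p)" "{rep (f p)}"], of c] by simp
    ultimately show ?thesis using span_point[OF \<open>f p \<in> pts UNIV\<close>] by simp
  qed
  then have "(`) g ` E = f ` E" by auto
  then show ?thesis using separating_image[OF g(1) V inj EV s] by simp
qed

section \<open>Restrictions of projective geometries\<close>

lemma subspace_coord_space: "vs.subspace (coord_space k :: (nat \<Rightarrow> 'f::field) set)"
  by (simp add: vs.subspace_def coord_space_def vscale_def)

lemma ground_PG: "ground (PG k) = pts (coord_space k)"
  by (simp add: PG_def PG_points_eq_pts)

lemma finite_ground_PG: "finite (pts (coord_space k :: (nat \<Rightarrow> 'f::{field,finite}) set))"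
  by (rule finite_pts[OF finite_coord_space])

text \<open>Replaces the existential choice of representatives in \<open>PG\<close> by the fixed
  \<open>rep\<close>. Representatives of distinct points are distinct, so cardinalities
  agree.\<close>

lemma indeps_PG:
  "X \<in> indeps (PG k :: (nat \<Rightarrow> 'f::{field,finite}) set matroid) \<longleftrightarrow>
     X \<subseteq> pts (coord_space k) \<and> prank X = card X"
proof
  assume "X \<in> indeps (PG k :: (nat \<Rightarrow> 'f) set matroid)"
  then obtain \<rho> where X: "X \<subseteq> pts (coord_space k)" and \<rho>: "\<forall>p\<in>X. \<rho> p \<in> p \<and> \<rho> p \<noteq> 0"
      and ind: "vs.independent (\<rho> ` X)"
    by (auto simp: PG_def PG_points_eq_pts)
  have Xp: "X \<subseteq> pts UNIV" using X by (rule subset_pts_UNIV)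
  have "inj_on \<rho> X"
  proof (rule inj_onI)
    fix x y assume xy: "x \<in> X" "y \<in> X" "\<rho> x = \<rho> y"
    have "vs.span {\<rho> z} = z" if "z \<in> X" for z
      by (rule span_point) (use that Xp \<rho> in blast)+
    from this[OF xy(1)] this[OF xy(2)] show "x = y" unfolding xy(3) by (rule trans[OF sym])
  qed
  then have "card X = card (\<rho> ` X)" by (simp add: card_image)
  also have "\<dots> = vs.dim (\<rho> ` X)" using ind by (simp add: vs.dim_eq_card_independent)
  also have "\<dots> = prank X"
    unfolding prank_def by (rule vs.span_eq_dim[OF span_reps[OF Xp]]) (use \<rho> in auto)
  finally show "X \<subseteq> pts (coord_space k) \<and> prank X = card X" using X by simp
next
  assume X: "X \<subseteq> pts (coord_space k) \<and> prank X = card X"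
  then have Xp: "X \<subseteq> pts UNIV" using subset_pts_UNIV by blast
  have fin: "finite X" using X finite_ground_PG finite_subset by blast
  have "card (rep ` X) = card X" using inj_on_rep[OF Xp] by (rule card_image)
  then have "vs.independent (rep ` X)"
    using X vs_dim_eq_card_iff[of "rep ` X"] fin by (simp add: prank_def)
  moreover have "\<forall>p\<in>X. rep p \<in> p \<and> rep p \<noteq> 0" using rep_point Xp by blast
  ultimately show "X \<in> indeps (PG k :: (nat \<Rightarrow> 'f) set matroid)"
    using X by (auto simp: PG_def PG_points_eq_pts)
qed

lemma rk_PG:
  assumes "X \<subseteq> pts (coord_space k :: (nat \<Rightarrow> 'f::{field,finite}) set)"
  shows "rk (PG k) X = prank X"
proof -
  have "{I \<in> indeps (PG k). I \<subseteq> X} = {I. I \<subseteq> X \<and> prank I = card I}"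
    using assms by (auto simp: indeps_PG)
  moreover have "finite X" using assms finite_ground_PG finite_subset by blast
  ultimately show ?thesis unfolding rk_def by (simp add: prank.Max_card_independent)
qed

lemma connected_restrict_PG_iff:
  assumes E: "E \<subseteq> pts (coord_space k :: (nat \<Rightarrow> 'f::{field,finite}) set)"
  shows "connected_matroid (restrict_to (PG k) E) \<longleftrightarrow> inseparable prank E"
proof -
  have fin: "finite E" using E finite_ground_PG finite_subset by blast
  have "circuit (restrict_to (PG k) E) C \<longleftrightarrow> C \<subseteq> E \<and> rank_circuit prank C" for C
  proof (cases "C \<subseteq> E")
    case True
    then have fC: "finite C" using fin finite_subset by blast
    have "D \<in> indeps (restrict_to (PG k) E) \<longleftrightarrow> prank D = card D" if "D \<subseteq> C" for D
      using that True E by (auto simp: restrict_to_def indeps_PG)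
    moreover have "ground (restrict_to (PG k) E) = E" by (simp add: restrict_to_def)
    ultimately show ?thesis
      using True fC prank.rank_le_card[OF fC] unfolding circuit_def rank_circuit_def
      by (auto simp: psubset_imp_subset)
  qed (auto simp: circuit_def restrict_to_def)
  then show ?thesis
    unfolding connected_matroid_def prank.inseparable_iff_rank_circuits[OF fin]
    by (auto simp: restrict_to_def)
qed

text \<open>The closure of a set of points consists of the points of the span of its
  representatives.\<close>

lemma flat_PG_iff:
  fixes F :: "(nat \<Rightarrow> 'f::{field,finite}) set set"
  shows "flat (PG k) F \<longleftrightarrow> (\<exists>U. vs.subspace U \<and> U \<subseteq> coord_space k \<and> F = pts U)"
proof -
  have cl: "closure_of (PG k) F = pts (vs.span (rep ` F))" and sp: "vs.span (rep ` F) \<subseteq> coord_space k"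
    if F: "F \<subseteq> pts (coord_space k)" for F :: "(nat \<Rightarrow> 'f) set set"
  proof -
    have fin: "finite F" using F finite_ground_PG finite_subset by blast
    show sp: "vs.span (rep ` F) \<subseteq> coord_space k"
      using F rep_in_subspace[OF subspace_coord_space] subspace_coord_space
      by (intro vs.span_minimal) auto
    have "e \<in> closure_of (PG k) F \<longleftrightarrow> e \<in> pts (coord_space k) \<and> rep e \<in> vs.span (rep ` F)" for e
      using F fin rk_PG[of F k] rk_PG[of "insert e F" k] vs_dim_insert_eq_iff[of "rep ` F" "rep e"]
      by (auto simp: closure_of_def ground_PG prank_def)
    moreover have "e \<in> pts (coord_space k) \<and> rep e \<in> vs.span (rep ` F) \<longleftrightarrow> e \<in> pts (vs.span (rep ` F))" for e
      using in_ptsI[of e] rep_in_subspace[OF vs.subspace_span, of e] pts_mono[OF sp] pts_UNIV[of e] by blast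
    ultimately show "closure_of (PG k) F = pts (vs.span (rep ` F))" by blast
  qed
  show ?thesis
  proof
    assume "flat (PG k) F"
    then show "\<exists>U. vs.subspace U \<and> U \<subseteq> coord_space k \<and> F = pts U"
      using cl sp unfolding flat_def ground_PG by (intro exI[of _ "vs.span (rep ` F)"]) auto
  next
    assume "\<exists>U. vs.subspace U \<and> U \<subseteq> coord_space k \<and> F = pts U"
    then obtain U where U: "vs.subspace U" "U \<subseteq> coord_space k" "F = pts U" by blast
    then show "flat (PG k) F"
      using cl[of F] pts_mono[OF U(2)] span_rep_pts[OF U(1)] unfolding flat_def ground_PG by simp
  qed
qed

text \<open>Flats of \<open>PG k\<close> are the subspaces of \<open>coord_space k\<close>; any
  other finite subspace gives unequal ranks by \<open>subspace_le_of_equal_ranks\<close>.\<close>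

lemma separating_iff_flats:
  assumes E: "E \<subseteq> pts (coord_space k :: (nat \<Rightarrow> 'f::{field,finite}) set)"
  shows "separating E \<longleftrightarrow>
    (\<forall>F. flat (PG k) F \<and> rk (PG k) (F \<inter> E) = rk (PG k) (F - E) \<longrightarrow>
       disconnected_matroid (restrict_to (PG k) (F \<inter> E)) \<or>
       disconnected_matroid (restrict_to (PG k) (F - E)))" (is "_ \<longleftrightarrow> ?R")
proof -
  have eq: "rk (PG k) (pts U \<inter> E) = prank (pts U \<inter> E)" "rk (PG k) (pts U - E) = prank (pts U - E)"
    "connected_matroid (restrict_to (PG k) (pts U \<inter> E)) = inseparable prank (pts U \<inter> E)"
    "connected_matroid (restrict_to (PG k) (pts U - E)) = inseparable prank (pts U - E)"
    if "U \<subseteq> coord_space k" for U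
    using pts_mono[OF that] by (auto intro!: rk_PG connected_restrict_PG_iff)
  show ?thesis
  proof
    assume s: "separating E"
    show ?R
    proof (intro allI impI)
      fix F assume F: "flat (PG k) F \<and> rk (PG k) (F \<inter> E) = rk (PG k) (F - E)"
      then obtain U where U: "vs.subspace U" "U \<subseteq> coord_space k" "F = pts U"
        unfolding flat_PG_iff by blast
      have "finite U" using U(2) finite_coord_space finite_subset by blast
      then show "disconnected_matroid (restrict_to (PG k) (F \<inter> E)) \<or>
          disconnected_matroid (restrict_to (PG k) (F - E))"
        using separatingD[OF s U(1)] F unfolding U(3) eq[OF U(2)] by blast
    qed
  next
    assume R: ?R
    show "separating E"
    proof (rule separatingI)
      fix U :: "(nat \<Rightarrow> 'f) set"
      assume U: "vs.subspace U" "finite U"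
        and h: "prank (pts U \<inter> E) = prank (pts U - E)"
          "inseparable prank (pts U \<inter> E)" "inseparable prank (pts U - E)"
      have Uk: "U \<subseteq> coord_space k"
        by (rule subspace_le_of_equal_ranks[OF subspace_coord_space E U h(1)])
      then have "flat (PG k) (pts U)" using U(1) by (auto simp: flat_PG_iff)
      then show False using R[rule_format, of "pts U"] h unfolding eq[OF Uk] by blast
    qed
  qed
qed

section \<open>Isomorphisms\<close>

lemma isomorphic_sym:
  assumes "isomorphic M N"
  shows "isomorphic N M"
proof -
  obtain f where M: "matroid M" "matroid N" and f: "bij_betw f (ground M) (ground N)"
      and ind: "\<forall>X\<subseteq>ground M. X \<in> indeps M \<longleftrightarrow> f ` X \<in> indeps N"
    using assms by (auto simp: isomorphic_def)
  define h where "h = inv_into (ground M) f"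
  have h: "bij_betw h (ground N) (ground M)" unfolding h_def by (rule bij_betw_inv_into[OF f])
  have "X \<in> indeps N \<longleftrightarrow> h ` X \<in> indeps M" if "X \<subseteq> ground N" for X
  proof -
    have "f ` h ` X = X"
      using that f unfolding h_def bij_betw_def by (metis image_inv_into_cancel)
    moreover have "h ` X \<subseteq> ground M" using that h by (auto simp: bij_betw_def)
    ultimately show ?thesis using ind by auto
  qed
  then show ?thesis using M h by (auto simp: isomorphic_def)
qed

lemma isomorphic_trans:
  assumes "isomorphic M N" "isomorphic N L"
  shows "isomorphic M L"
proof -
  obtain f where M: "matroid M" and f: "bij_betw f (ground M) (ground N)"
      and indf: "\<forall>X\<subseteq>ground M. X \<in> indeps M \<longleftrightarrow> f ` X \<in> indeps N"
    using assms(1) by (auto simp: isomorphic_def)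
  obtain h where L: "matroid L" and h: "bij_betw h (ground N) (ground L)"
      and indh: "\<forall>X\<subseteq>ground N. X \<in> indeps N \<longleftrightarrow> h ` X \<in> indeps L"
    using assms(2) by (auto simp: isomorphic_def)
  have "X \<in> indeps M \<longleftrightarrow> (h \<circ> f) ` X \<in> indeps L" if "X \<subseteq> ground M" for X
  proof -
    have "f ` X \<subseteq> ground N" using that f by (auto simp: bij_betw_def)
    then show ?thesis using that indf indh by (simp add: image_comp)
  qed
  then show ?thesis using M L bij_betw_trans[OF f h] unfolding isomorphic_def by blast
qed

lemma isomorphic_refl: "matroid M \<Longrightarrow> isomorphic M M"
  unfolding isomorphic_def by (intro conjI exI[of _ id]) auto

lemma matroid_restrict_PG:
  "E \<subseteq> pts (coord_space k) \<Longrightarrow> matroid (restrict_to (PG k :: (nat \<Rightarrow> 'f::{field,finite}) set matroid) E)"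
  using matroid_restrict_to[OF matroid_PG] by (simp add: ground_PG)

text \<open>Independence is rank equal to cardinality, so a bijection preserving independence
  preserves all ranks by \<open>rank_eq_of_independent_iff\<close>.\<close>

lemma isomorphic_restrict_PG_iff:
  fixes E E' :: "(nat \<Rightarrow> 'f::{field,finite}) set set"
  assumes E: "E \<subseteq> pts (coord_space k)" and E': "E' \<subseteq> pts (coord_space l)"
  shows "isomorphic (restrict_to (PG k) E) (restrict_to (PG l) E') \<longleftrightarrow>
    (\<exists>f. bij_betw f E E' \<and> (\<forall>X\<subseteq>E. prank (f ` X) = prank X))" (is "?L \<longleftrightarrow> ?R")
proof -
  have fin: "finite E" using E finite_ground_PG finite_subset by blast
  have ind: "X \<in> indeps (restrict_to (PG k) E) \<longleftrightarrow> prank X = card X"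
      "f ` X \<in> indeps (restrict_to (PG l) E') \<longleftrightarrow> prank (f ` X) = card (f ` X)"
    if "bij_betw f E E'" "X \<subseteq> E" for f X
  proof -
    have "f ` X \<subseteq> E'" using that by (auto simp: bij_betw_def)
    then show "X \<in> indeps (restrict_to (PG k) E) \<longleftrightarrow> prank X = card X"
      "f ` X \<in> indeps (restrict_to (PG l) E') \<longleftrightarrow> prank (f ` X) = card (f ` X)"
      using E E' that(2) by (auto simp: restrict_to_def indeps_PG)
  qed
  show ?thesis
  proof
    assume ?L
    then obtain f where f: "bij_betw f E E'"
        and iff: "\<forall>X\<subseteq>E. X \<in> indeps (restrict_to (PG k) E) \<longleftrightarrow> f ` X \<in> indeps (restrict_to (PG l) E')"
      by (auto simp: isomorphic_def restrict_to_def)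
    have "prank (f ` X) = prank X" if "X \<subseteq> E" for X
    proof (rule rank_eq_of_independent_iff[OF prank.rank_function_axioms prank.rank_function_axioms fin _ _ that])
      show "inj_on f E" using f by (simp add: bij_betw_def)
      show "prank I = card I \<longleftrightarrow> prank (f ` I) = card (f ` I)" if "I \<subseteq> E" for I
        using iff ind[OF f that] that by blast
    qed
    then show ?R using f by blast
  next
    assume ?R
    then obtain f where f: "bij_betw f E E'" "\<forall>X\<subseteq>E. prank (f ` X) = prank X" by blast
    have "X \<in> indeps (restrict_to (PG k) E) \<longleftrightarrow> f ` X \<in> indeps (restrict_to (PG l) E')" if "X \<subseteq> E" for X
    proof -
      have "card (f ` X) = card X"
        using f(1) that by (meson bij_betw_def card_image inj_on_subset)
      then show ?thesis using ind[OF f(1) that] f(2) that by simp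
    qed
    then show ?L
      using f(1) matroid_restrict_PG[OF E] matroid_restrict_PG[OF E']
      by (auto simp: isomorphic_def restrict_to_def)
  qed
qed

text \<open>Complements are taken in the geometries \<open>PG t\<close> only; this moves an
  arbitrary finite subspace onto a coordinate space.\<close>

lemma linear_iso_coord_space:
  fixes V :: "(nat \<Rightarrow> 'f::{field,finite}) set"
  assumes V: "vs.subspace V" "finite V"
  obtains g where "lin g" "inj_on g V" "g ` V = coord_space (vs.dim V)"
proof -
  define n where "n = vs.dim V"
  \<comment> \<open>The standard basis of \<open>coord_space n\<close>.\<close>
  define e :: "nat \<Rightarrow> nat \<Rightarrow> 'f" where "e i = (\<lambda>j. if j = i then 1 else 0)" for i
  let ?C = "e ` {..<n}"
  have inj: "inj_on e {..<n}"
    by (rule inj_onI) (metis e_def zero_neq_one)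
  have ind: "vs.independent ?C"
  proof (rule vs.independent_if_scalars_zero)
    fix c x assume s: "(\<Sum>x\<in>?C. vscale (c x) x) = 0" and "x \<in> ?C"
    then obtain i where i: "i < n" "x = e i" by auto
    have "(\<Sum>x\<in>?C. vscale (c x) x) = (\<Sum>j<n. vscale (c (e j)) (e j))"
      by (simp add: sum.reindex[OF inj])
    then have "0 = (\<Sum>j<n. vscale (c (e j)) (e j)) i" using s by simp
    also have "\<dots> = (\<Sum>j<n. vscale (c (e j)) (e j) i)"
      by (induction n) auto
    also have "\<dots> = (\<Sum>j<n. if i = j then c (e j) else 0)"
      by (intro sum.cong) (auto simp: vscale_def e_def)
    also have "\<dots> = c (e i)" using i(1) by simp
    finally show "c x = 0" using i by simp
  qed simp
  have sub: "?C \<subseteq> coord_space n" by (auto simp: coord_space_def e_def)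
  have span: "coord_space n \<subseteq> vs.span ?C"
  proof
    fix v :: "nat \<Rightarrow> 'f" assume v: "v \<in> coord_space n"
    have "v i = (\<Sum>j<n. vscale (v j) (e j)) i" for i
    proof -
      have "(\<Sum>j<n. vscale (v j) (e j)) i = (\<Sum>j<n. vscale (v j) (e j) i)"
        by (induction n) auto
      also have "\<dots> = (\<Sum>j<n. if i = j then v j else 0)"
        by (intro sum.cong) (auto simp: vscale_def e_def)
      also have "\<dots> = v i" using v by (auto simp: coord_space_def)
      finally show ?thesis by simp
    qed
    then have "v = (\<Sum>j<n. vscale (v j) (e j))" by (rule ext)
    also have "\<dots> \<in> vs.span ?C" by (intro vs.span_sum vs.span_scale vs.span_base) auto
    finally show "v \<in> vs.span ?C" .
  qed
  have cC: "card ?C = n" using inj by (simp add: card_image)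
  have dim: "vs.dim (coord_space n :: (nat \<Rightarrow> 'f) set) = n"
    using vs.basis_card_eq_dim[OF sub span ind] cC by simp
  obtain B where B: "finite B" "B \<subseteq> V" "vs.independent B" "vs.span B = vs.span V" "card B = vs.dim V"
    using basis_of_finite[OF V(2)] by metis
  have "V \<subseteq> vs.span B" using B(4) vs.span_superset[of V] by simp
  then obtain g where "lin g" "g ` V = coord_space n" "inj_on g V"
    using vp.finite_basis_to_basis_subspace_isomorphism[OF V(1) subspace_coord_space _ B(1,2,3) _ B(5) _ sub ind span]
      dim cC n_def by auto
  then show thesis using that n_def by blast
qed

section \<open>Comatroids\<close>

text \<open>A linear isomorphism of \<open>V\<close> with a coordinate space turns the complement
  within \<open>V\<close> into a complement in the sense of \<open>is_complement\<close>, with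
  \<open>t\<close> the dimension of \<open>V\<close>.\<close>

lemma comatroid_complement_in_subspace:
  fixes V :: "(nat \<Rightarrow> 'f::{field,finite}) set"
  assumes V: "vs.subspace V" "V \<subseteq> coord_space k" and E: "E \<subseteq> pts V"
    and c: "comatroid (restrict_to (PG k) E)"
  shows "comatroid (restrict_to (PG k) (pts V - E))"
proof -
  have fV: "finite V" using V(2) finite_coord_space finite_subset by blast
  have Vk: "pts V \<subseteq> pts (coord_space k)" using pts_mono[OF V(2)] .
  define n where "n = vs.dim V"
  obtain g where g: "lin g" "inj_on g V" "g ` V = coord_space n"
    using linear_iso_coord_space[OF V(1) fV] n_def by metis
  note inj = inj_on_image_points[OF g(1) V(1) fV g(2)]
  have im: "(`) g ` pts V = pts (coord_space n)"
    using pts_image[OF g(1) V(1) fV g(2)] g(3) by simp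
  have iso: "isomorphic (restrict_to (PG k) X) (restrict_to (PG n) ((`) g ` X))" if X: "X \<subseteq> pts V" for X
  proof -
    have sub: "X \<subseteq> pts (coord_space k)" "(`) g ` X \<subseteq> pts (coord_space n)" using X Vk im by auto
    have "bij_betw ((`) g) X ((`) g ` X)"
      using inj_on_subset[OF inj X] by (simp add: bij_betw_def)
    moreover have "\<forall>Y\<subseteq>X. prank ((`) g ` Y) = prank Y"
      using prank_image_points[OF g(1) V(1) fV g(2)] X by blast
    ultimately show ?thesis unfolding isomorphic_restrict_PG_iff[OF sub] by blast
  qed
  have "pts (coord_space n) - (`) g ` E = (`) g ` (pts V - E)"
    using inj_on_image_set_diff[OF inj _ E, of "pts V"] im by auto
  then have "is_complement n (restrict_to (PG k) E) (restrict_to (PG k) (pts V - E))"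
    unfolding is_complement_def delete_def ground_PG
    using iso[OF E] iso[OF Diff_subset] image_mono[OF E, of "(`) g"] im
    by (intro exI[of _ "(`) g ` E"]) auto
  moreover have "rank (restrict_to (PG k) E) \<le> n"
  proof -
    have "rank (restrict_to (PG k) E) = rk (PG k) E"
      by (simp add: rank_def rk_def restrict_to_def)
    also have "\<dots> = prank E" using E Vk by (intro rk_PG) auto
    also have "\<dots> \<le> prank (pts V)" using E finite_pts[OF fV] by (intro prank.mono)
    finally show ?thesis using prank_pts[OF V(1)] n_def by simp
  qed
  ultimately show ?thesis using comatroid.complement[OF c] by blast
qed

text \<open>Additivity of rank restricts to subsets, so independent sets of the two sides have an
  independent union. The matroids are equal, not only isomorphic.\<close>

lemma direct_sum_restrict_PG:
  fixes A B :: "(nat \<Rightarrow> 'f::{field,finite}) set set"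
  assumes "A \<union> B \<subseteq> pts (coord_space k)" "A \<inter> B = {}" "prank A + prank B \<le> prank (A \<union> B)"
  shows "direct_sum (restrict_to (PG k) A) (restrict_to (PG k) B) = restrict_to (PG k) (A \<union> B)"
proof -
  have fin: "finite A" "finite B" using assms(1) finite_ground_PG finite_subset by blast+
  have "I \<in> indeps (PG k) \<and> I \<subseteq> A \<union> B \<longleftrightarrow>
     (\<exists>I1 I2. I = I1 \<union> I2 \<and> (I1 \<in> indeps (PG k) \<and> I1 \<subseteq> A) \<and> (I2 \<in> indeps (PG k) \<and> I2 \<subseteq> B))" for I
  proof
    assume I: "I \<in> indeps (PG k) \<and> I \<subseteq> A \<union> B"
    then have "I = (I \<inter> A) \<union> (I \<inter> B)" by auto
    moreover have "I \<inter> A \<in> indeps (PG k)" "I \<inter> B \<in> indeps (PG k)"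
      using I matroid.indep_mono[OF matroid_PG] by blast+
    ultimately show "\<exists>I1 I2. I = I1 \<union> I2 \<and> (I1 \<in> indeps (PG k) \<and> I1 \<subseteq> A) \<and> (I2 \<in> indeps (PG k) \<and> I2 \<subseteq> B)"
      by blast
  next
    assume "\<exists>I1 I2. I = I1 \<union> I2 \<and> (I1 \<in> indeps (PG k) \<and> I1 \<subseteq> A) \<and> (I2 \<in> indeps (PG k) \<and> I2 \<subseteq> B)"
    then obtain I1 I2 where I: "I = I1 \<union> I2" "I1 \<subseteq> A" "I2 \<subseteq> B"
        "prank I1 = card I1" "prank I2 = card I2"
      by (auto simp: indeps_PG)
    have sub: "I \<subseteq> A \<union> B" using I by auto
    have e: "I \<inter> A = I1" "I \<inter> B = I2" using I assms(2) by auto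
    have f: "finite I1" "finite I2" using I fin finite_subset by auto
    have "prank I1 + prank I2 \<le> prank I"
      using prank.separation_restrict[OF fin assms(2,3) sub] unfolding e .
    moreover have "card I = card I1 + card I2"
      using card_Un_disjoint[OF f] I assms(2) by auto
    ultimately have "prank I = card I"
      using prank.rank_le_card[of I] I f by simp
    then show "I \<in> indeps (PG k) \<and> I \<subseteq> A \<union> B" using sub assms(1) by (auto simp: indeps_PG)
  qed
  then show ?thesis unfolding direct_sum_def restrict_to_def by auto
qed

lemma comatroid_sum_in_PG:
  fixes A B :: "(nat \<Rightarrow> 'f::{field,finite}) set set"
  assumes "A \<union> B \<subseteq> pts (coord_space k)" "A \<inter> B = {}" "prank A + prank B \<le> prank (A \<union> B)"
    and "comatroid (restrict_to (PG k) A)" "comatroid (restrict_to (PG k) B)"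
  shows "comatroid (restrict_to (PG k) (A \<union> B))"
proof -
  have "ground (restrict_to (PG k) A) \<inter> ground (restrict_to (PG k) B) = {}"
    using assms(2) by (simp add: restrict_to_def)
  from comatroid.sum[OF assms(4,5) this] show ?thesis unfolding direct_sum_restrict_PG[OF assms(1-3)] .
qed

lemma restrict_PG_empty: "restrict_to (PG k :: (nat \<Rightarrow> 'f::{field,finite}) set matroid) {} = U00"
  using matroid.empty_indep[OF matroid_PG[of k]] by (auto simp: restrict_to_def U00_def)

text \<open>The spans of the two sides share only 0, so no point of \<open>B\<close> outside
  \<open>A\<close> lies in the flat spanned by \<open>A\<close>. Thus
  \<open>separating_Int_pts\<close> applies to each side.\<close>

lemma separation_Int_pts:
  fixes A B :: "(nat \<Rightarrow> 'f::field) set set"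
  assumes fin: "finite A" "finite B" and p: "A \<union> B \<subseteq> pts UNIV" 
    and sep: "prank A + prank B \<le> prank (A \<union> B)"
  shows "(A \<union> B) \<inter> pts (vs.span (rep ` A)) = A"
proof
  show "A \<subseteq> (A \<union> B) \<inter> pts (vs.span (rep ` A))"
    using subset_pts_span_rep[of A] p by auto
  show "(A \<union> B) \<inter> pts (vs.span (rep ` A)) \<subseteq> A"
  proof
    fix x assume x: "x \<in> (A \<union> B) \<inter> pts (vs.span (rep ` A))"
    show "x \<in> A"
    proof (rule ccontr)
      assume "x \<notin> A"
      then have xB: "x \<in> B" using x by auto
      have "rep x = 0"
      proof (rule separation_span_Int[of "rep ` A" "rep ` B"])
        show "vs.dim (rep ` A) + vs.dim (rep ` B) \<le> vs.dim (rep ` A \<union> rep ` B)"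
          using sep by (simp add: prank_def image_Un)
        show "rep x \<in> vs.span (rep ` A)" using rep_in_subspace[OF vs.subspace_span] x by blast
        show "rep x \<in> vs.span (rep ` B)" using xB by (auto intro: vs.span_base)
      qed (use fin in auto)
      then show False using rep_point(2)[of x] xB p by auto
    qed
  qed
qed

theorem comatroid_of_separating:
  fixes V :: "(nat \<Rightarrow> 'f::{field,finite}) set"
  assumes "vs.subspace V" "V \<subseteq> coord_space k" "E \<subseteq> pts V" "separating E"
  shows "comatroid (restrict_to (PG k) E)"
  using assms
proof (induction "vs.dim V" arbitrary: V E rule: less_induct)
  case less
  note V = less.prems(1,2)
  have fV: "finite V" using V(2) finite_coord_space finite_subset by blast
  have fp: "finite (pts V)" using finite_pts[OF fV] .
  have Vk: "pts V \<subseteq> pts (coord_space k)" using pts_mono[OF V(2)] .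
  \<comment> \<open>\<open>A\<close> consists of points of its own span, whose dimension is below
    that of \<open>V\<close>, so the induction hypothesis applies to that span.\<close>
  have small: "comatroid (restrict_to (PG k) A)"
    if A: "A \<subseteq> pts V" "separating A" "prank A < vs.dim V" for A
  proof (rule less.hyps)
    show "vs.dim (vs.span (rep ` A)) < vs.dim V" using A(3) by (simp add: prank_def)
    show "vs.span (rep ` A) \<subseteq> coord_space k"
      using A(1) Vk rep_in_subspace[OF subspace_coord_space] subspace_coord_space
      by (intro vs.span_minimal) auto
    show "A \<subseteq> pts (vs.span (rep ` A))"
      by (rule subset_pts_span_rep[OF subset_pts_UNIV[OF A(1)]])
  qed (use A in auto)
  have split: "comatroid (restrict_to (PG k) D)"
    if D: "D \<subseteq> pts V" "separating D" "\<not> inseparable prank D" for D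
  proof (cases "D = {}")
    case True
    then show ?thesis using comatroid.empty restrict_PG_empty by metis
  next
    case False
    obtain A B where AB: "A \<union> B = D" "A \<inter> B = {}" "A \<noteq> {}" "B \<noteq> {}" "prank A + prank B \<le> prank D"
      using not_inseparableE[OF D(3) False] by metis
    have fin: "finite A" "finite B" using AB(1) D(1) fp finite_subset by blast+
    have up: "A \<union> B \<subseteq> pts UNIV" using AB(1) subset_pts_UNIV[OF D(1)] by simp
    \<comment> \<open>Both parts have positive rank, so each has rank below the dimension of
      \<open>V\<close> and falls under \<open>small\<close>.\<close>
    have pos: "0 < prank X" if X: "X \<noteq> {}" "X \<subseteq> D" for X
    proof -
      obtain x where x: "x \<in> X" using X by blast
      have "rep x \<noteq> 0" using rep_point(2)[of x] x X(2) subset_pts_UNIV[OF D(1)] by blast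
      then have "prank {x} = 1" by (simp add: prank_def vs_dim_singleton)
      moreover have "prank {x} \<le> prank X"
        using x X(2) D(1) fp finite_subset[of X "pts V"] by (intro prank.mono) auto
      ultimately show ?thesis by simp
    qed
    have le: "prank D \<le> vs.dim V" using prank.mono[OF fp D(1)] prank_pts[OF V(1)] by simp
    have "prank A < vs.dim V" "prank B < vs.dim V"
      using pos[of A] pos[of B] AB le by auto
    moreover have "separating A" "separating B"
      using separating_Int_pts[OF D(2) vs.subspace_span, of "rep ` A"]
        separating_Int_pts[OF D(2) vs.subspace_span, of "rep ` B"]
        separation_Int_pts[OF fin up] separation_Int_pts[OF fin(2,1)] up AB(1,5)
      by (simp_all add: Un_commute add.commute)
    moreover have "A \<subseteq> pts V" "B \<subseteq> pts V" using AB(1) D(1) by auto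
    ultimately have "comatroid (restrict_to (PG k) A)" "comatroid (restrict_to (PG k) B)"
      using small by auto
    then have "comatroid (restrict_to (PG k) (A \<union> B))"
      using AB(1,2,5) D(1) Vk by (intro comatroid_sum_in_PG) auto
    then show ?thesis using AB(1) by simp
  qed
  let ?E = "pts V - E"
  have E: "E \<subseteq> pts V" "separating E" by fact+
  have cs: "separating ?E" using separating_complement[OF E(2) V(1) E(1)] .
  have compl: "comatroid (restrict_to (PG k) E)" if "comatroid (restrict_to (PG k) ?E)"
  proof -
    have "pts V - ?E = E" using E(1) by auto
    then show ?thesis
      using comatroid_complement_in_subspace[OF V Diff_subset that] by simp
  qed
  have le: "prank E \<le> vs.dim V" "prank ?E \<le> vs.dim V"
    using prank.mono[OF fp E(1)] prank.mono[OF fp, of ?E] prank_pts[OF V(1)] by auto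
  show ?case
  proof (cases "prank E = vs.dim V \<and> prank ?E = vs.dim V")
    case True
    have "pts V \<inter> E = E" using E(1) by auto
    \<comment> \<open>The condition \<open>separating\<close> is used for \<open>V\<close> itself,
      where both parts have full rank.\<close>
    then have "\<not> (inseparable prank E \<and> inseparable prank ?E)"
      using separatingD[OF E(2) V(1) fV] True by auto
    then show ?thesis using split[OF E] split[OF Diff_subset cs] compl by blast
  next
    case False
    then show ?thesis using small[OF E] small[OF Diff_subset cs] compl le by fastforce
  qed
qed

section \<open>From comatroids to the separating property\<close>

text \<open>Supplies the properties by which \<open>restrict_direct_sum\<close> recovers the
  summands of a direct sum.\<close>

lemma comatroid_wellformed:
  fixes M :: "(nat \<Rightarrow> 'f::{field,finite}) set matroid"
  shows "comatroid M \<Longrightarrow> {} \<in> indeps M \<and> (\<forall>I\<in>indeps M. I \<subseteq> ground M)"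
proof (induction rule: comatroid.induct)
  case empty
  show ?case by (simp add: U00_def)
next
  case (sum M N)
  have "\<exists>I J. {} = I \<union> J \<and> I \<in> indeps M \<and> J \<in> indeps N"
    using sum.IH by (intro exI[of _ "{}"]) simp
  moreover have "I \<union> J \<subseteq> ground M \<union> ground N" if "I \<in> indeps M" "J \<in> indeps N" for I J
    using sum.IH that by (intro Un_mono) simp_all
  ultimately show ?case by (auto simp: direct_sum_def)
next
  case (complement M t N)
  then have "matroid N" by (auto simp: is_complement_def isomorphic_def)
  then show ?case using matroid.empty_indep matroid.indeps_subset by blast
qed

lemma isomorphic_restrict:
  assumes iso: "isomorphic M (restrict_to P E)" and f: "bij_betw f (ground M) E"
    and ind: "\<forall>X\<subseteq>ground M. X \<in> indeps M \<longleftrightarrow> f ` X \<in> indeps (restrict_to P E)"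
    and A: "A \<subseteq> ground M"
  shows "isomorphic (restrict_to M A) (restrict_to P (f ` A))"
proof -
  have fA: "f ` A \<subseteq> E" using f A by (auto simp: bij_betw_def)
  have "matroid (restrict_to M A)" using iso A matroid_restrict_to by (auto simp: isomorphic_def)
  moreover have "matroid (restrict_to P (f ` A))"
  proof -
    have "restrict_to (restrict_to P E) (f ` A) = restrict_to P (f ` A)"
      using fA by (auto simp: restrict_to_def)
    then show ?thesis
      using iso fA matroid_restrict_to[of "restrict_to P E" "f ` A"]
      by (simp add: isomorphic_def restrict_to_def)
  qed
  moreover have "bij_betw f A (f ` A)" using f A by (meson bij_betw_def inj_on_subset)
  moreover have "X \<in> indeps (restrict_to M A) \<longleftrightarrow> f ` X \<in> indeps (restrict_to P (f ` A))" if "X \<subseteq> A" for X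
  proof -
    have "X \<subseteq> ground M" "f ` X \<subseteq> E" "f ` X \<subseteq> f ` A" using that A fA by auto
    then show ?thesis using ind[rule_format, of X] that by (simp add: restrict_to_def)
  qed
  ultimately show ?thesis unfolding isomorphic_def by (auto simp: restrict_to_def)
qed

lemma direct_sum_commute: "direct_sum M N = direct_sum N M"
proof -
  have "{I \<union> J | I J. I \<in> indeps M \<and> J \<in> indeps N} = {I \<union> J | I J. I \<in> indeps N \<and> J \<in> indeps M}"
    by (metis (no_types, opaque_lifting) Un_commute)
  then show ?thesis by (simp add: direct_sum_def Un_commute)
qed

text \<open>The part in \<open>N\<close> of an independent set inside \<open>ground M\<close> lies
  in both ground sets, hence is empty.\<close>

lemma restrict_direct_sum:
  fixes M N :: "'a matroid"
  assumes M: "\<And>I. I \<in> indeps M \<Longrightarrow> I \<subseteq> ground M"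
    and N: "{} \<in> indeps N" "\<And>I. I \<in> indeps N \<Longrightarrow> I \<subseteq> ground N"
    and disj: "ground M \<inter> ground N = {}"
  shows "restrict_to (direct_sum M N) (ground M) = M"
proof -
  have "{I \<in> indeps (direct_sum M N). I \<subseteq> ground M} = indeps M"
  proof (intro equalityI subsetI)
    fix I assume "I \<in> {I \<in> indeps (direct_sum M N). I \<subseteq> ground M}"
    then obtain A B where AB: "I = A \<union> B" "A \<in> indeps M" "B \<in> indeps N" "I \<subseteq> ground M"
      by (auto simp: direct_sum_def)
    then have "B \<subseteq> ground M \<inter> ground N" using N(2) by simp
    then have "B = {}" using disj by simp
    then show "I \<in> indeps M" using AB by simp
  next
    fix I assume I: "I \<in> indeps M"
    have "\<exists>A B. I = A \<union> B \<and> A \<in> indeps M \<and> B \<in> indeps N"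
      using I N(1) by (intro exI[of _ I] exI[of _ "{}"]) simp
    then show "I \<in> {I \<in> indeps (direct_sum M N). I \<subseteq> ground M}"
      using M[OF I] by (simp add: direct_sum_def)
  qed
  then show ?thesis by (simp add: restrict_to_def)
qed

text \<open>The claim is proved for every copy \<open>E\<close> of \<open>N\<close> in every
  \<open>PG k\<close>, so that the induction hypothesis fits the copies of the summands. Unique
  representability enters in the complement step, which passes from one copy to another.\<close>

theorem separating_of_comatroid:
  fixes N :: "(nat \<Rightarrow> 'f::{field,finite}) set matroid" and E :: "(nat \<Rightarrow> 'f) set set"
  assumes q: "CARD('f) \<in> {2, 3}" and "comatroid N" "E \<subseteq> pts (coord_space k)"
    and "isomorphic N (restrict_to (PG k) E)"
  shows "separating E"
  using assms(2-)
proof (induction arbitrary: E k rule: comatroid.induct)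
  case empty
  then have "E = {}" by (auto simp: isomorphic_def U00_def restrict_to_def bij_betw_def)
  then show ?case by (intro separatingI) (simp add: inseparable_def)
next
  case (sum M N)
  let ?S = "direct_sum M N"
  obtain f where f: "bij_betw f (ground ?S) E"
      and ind: "\<forall>X\<subseteq>ground ?S. X \<in> indeps ?S \<longleftrightarrow> f ` X \<in> indeps (restrict_to (PG k) E)"
    using sum.prems(2) by (auto simp: isomorphic_def restrict_to_def)
  note wfM = comatroid_wellformed[OF sum.hyps(1)] and wfN = comatroid_wellformed[OF sum.hyps(2)]
  have g: "ground ?S = ground M \<union> ground N" by (simp add: direct_sum_def)
  have rM: "restrict_to ?S (ground M) = M"
    by (rule restrict_direct_sum) (use wfM wfN sum.hyps(3) in auto)
  have rN: "restrict_to ?S (ground N) = N"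
    unfolding direct_sum_commute[of M] by (rule restrict_direct_sum) (use wfM wfN sum.hyps(3) in auto)
  define E1 E2 where "E1 = f ` ground M" and "E2 = f ` ground N"
  have isoM: "isomorphic M (restrict_to (PG k) E1)" and isoN: "isomorphic N (restrict_to (PG k) E2)"
    using isomorphic_restrict[OF sum.prems(2) f ind, of "ground M"]
      isomorphic_restrict[OF sum.prems(2) f ind, of "ground N"] g rM rN by (simp_all add: E1_def E2_def)
  have EE: "E1 \<union> E2 = E" using f g by (auto simp: bij_betw_def E1_def E2_def)
  have inj: "inj_on f (ground M \<union> ground N)" using f g by (simp add: bij_betw_def)
  have disj: "E1 \<inter> E2 = {}"
    unfolding E1_def E2_def using inj_on_image_Int[OF inj, of "ground M" "ground N"] sum.hyps(3) by auto
  have sub: "E1 \<subseteq> pts (coord_space k)" "E2 \<subseteq> pts (coord_space k)" using EE sum.prems(1) by auto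
  have fin: "finite E1" "finite E2" using sub finite_ground_PG finite_subset by blast+
  \<comment> \<open>Bases of the two images pull back to independent sets of \<open>M\<close> and
    \<open>N\<close>; their union is independent in the direct sum, so its image has full
    rank.\<close>
  have "prank E1 + prank E2 \<le> prank (E1 \<union> E2)"
  proof -
    obtain I1 where I1: "I1 \<subseteq> E1" "prank I1 = card I1" "prank I1 = prank E1"
      using prank.ex_basis[OF fin(1)] by blast
    obtain I2 where I2: "I2 \<subseteq> E2" "prank I2 = card I2" "prank I2 = prank E2"
      using prank.ex_basis[OF fin(2)] by blast
    obtain A where A: "A \<subseteq> ground M" "I1 = f ` A" using I1(1) unfolding E1_def by (auto simp: subset_image_iff)
    obtain B where B: "B \<subseteq> ground N" "I2 = f ` B" using I2(1) unfolding E2_def by (auto simp: subset_image_iff)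
    have inE: "I1 \<subseteq> E" "I2 \<subseteq> E" using I1(1) I2(1) EE by auto
    have "I1 \<in> indeps (restrict_to (PG k) E)" "I2 \<in> indeps (restrict_to (PG k) E)"
      using I1 I2 inE sum.prems(1) by (auto simp: restrict_to_def indeps_PG)
    then have "A \<in> indeps ?S" "B \<in> indeps ?S" using ind A B g by auto
    then have "A \<in> indeps (restrict_to ?S (ground M))" "B \<in> indeps (restrict_to ?S (ground N))"
      using A(1) B(1) by (auto simp: restrict_to_def)
    then have "A \<in> indeps M" "B \<in> indeps N" using rM rN by auto
    then have "A \<union> B \<in> indeps ?S" unfolding direct_sum_def by auto
    moreover have "A \<union> B \<subseteq> ground ?S" using A(1) B(1) g by auto
    ultimately have "f ` (A \<union> B) \<in> indeps (restrict_to (PG k) E)" using ind by blast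
    then have "prank (I1 \<union> I2) = card (I1 \<union> I2)"
      unfolding A(2) B(2) image_Un by (simp add: restrict_to_def indeps_PG)
    also have "\<dots> = card I1 + card I2"
      using I1(1) I2(1) disj fin by (intro card_Un_disjoint) (auto intro: finite_subset)
    finally have "prank (I1 \<union> I2) = prank E1 + prank E2" using I1 I2 by simp
    moreover have "prank (I1 \<union> I2) \<le> prank (E1 \<union> E2)"
      using I1(1) I2(1) fin by (intro prank.mono) auto
    ultimately show ?thesis by simp
  qed
  then have "separating (E1 \<union> E2)"
    using sum.IH(1)[OF sub(1) isoM] sum.IH(2)[OF sub(2) isoN] fin disj by (intro separating_sum)
  then show ?case using EE by simp
next
  case (complement M t N)
  from complement.hyps(3) obtain T :: "(nat \<Rightarrow> 'f) set set" where T: "T \<subseteq> pts (coord_space t)" "isomorphic M (restrict_to (PG t) T)"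
      "isomorphic N (restrict_to (PG t) (pts (coord_space t) - T))"
    unfolding is_complement_def delete_def ground_PG by blast
  let ?T = "pts (coord_space t) - T"
  have "separating T" by (rule complement.IH[OF T(1,2)])
  then have sep: "separating ?T" using separating_complement[OF _ subspace_coord_space T(1)] by blast
  have "isomorphic (restrict_to (PG t) ?T) (restrict_to (PG k) E)"
    using isomorphic_trans[OF isomorphic_sym[OF T(3)] complement.prems(2)] .
  then obtain f where f: "bij_betw f ?T E" "\<forall>X\<subseteq>?T. prank (f ` X) = prank X"
    using isomorphic_restrict_PG_iff[OF Diff_subset complement.prems(1)] by blast
  have fT: "f ` ?T = E" using f(1) by (simp add: bij_betw_def)
  have "separating (f ` ?T)"
  proof (rule separating_of_rank_isomorphism[OF q])
    show "finite ?T" using finite_ground_PG by blast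
    show "?T \<subseteq> pts UNIV" by (rule subset_pts_UNIV[OF Diff_subset])
    show "f ` ?T \<subseteq> pts UNIV" unfolding fT by (rule subset_pts_UNIV[OF complement.prems(1)])
  qed (use f sep in auto)
  then show ?case using fT by simp
qed

theorem theorem1p1:
  fixes q :: nat and M :: "(nat \<Rightarrow> 'f::{field,finite}) set matroid"
  assumes "q \<in> {2, 3}" and "CARD('f) = q"
    and "simple_matroid M" and "representable TYPE('f) M"
    and "ground M \<subseteq> ground (PG (rank M) :: (nat \<Rightarrow> 'f) set matroid)"
    and "M = restrict_to (PG (rank M)) (ground M)"
  shows "comatroid M \<longleftrightarrow>
    M = U00 \<or>
    (\<forall>F. flat (PG (rank M)) F \<and>
         rk (PG (rank M)) (F \<inter> ground M) = rk (PG (rank M)) (F - ground M) \<longrightarrow>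
         disconnected_matroid (restrict_to (PG (rank M)) (F \<inter> ground M)) \<or>
         disconnected_matroid (restrict_to (PG (rank M)) (F - ground M)))"
proof -
  define k where "k = rank M"
  define E where "E = ground M"
  have E: "E \<subseteq> pts (coord_space k)" using assms(5) by (simp add: k_def E_def ground_PG)
  have M: "M = restrict_to (PG k) E" using assms(6) by (simp add: k_def E_def)
  have q: "CARD('f) \<in> {2, 3}" using assms(1,2) by simp
  have "comatroid M \<longleftrightarrow> separating E"
  proof
    assume c: "comatroid M"
    have "isomorphic M (restrict_to (PG k) E)"
      using isomorphic_refl[OF matroid_restrict_PG[OF E]] M by simp
    then show "separating E" by (rule separating_of_comatroid[OF q c E])
  next
    assume "separating E"
    then have "comatroid (restrict_to (PG k) E)"
      by (rule comatroid_of_separating[OF subspace_coord_space order_refl E])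
    then show "comatroid M" using M by simp
  qed
  \<comment> \<open>Settles the first disjunct; the second is \<open>separating E\<close> by
    \<open>separating_iff_flats\<close>.\<close>
  moreover have "comatroid M" if "M = U00" using that comatroid.empty by simp
  ultimately show ?thesis
    using separating_iff_flats[OF E] unfolding k_def E_def by blast
qed

end
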